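(* Let $\bar\delta\ge0$ and consider the rescaled equation with $\delta=\varepsilon\bar\delta$, $$\partial_Tu+6u\,\partial_Xu+\varepsilon^2\partial_X^3u+\bar\delta\big(\varepsilon^2\partial_X^2u+\varepsilon^4\partial_X^4u\big)=0,\qquad(\ast)$$ and a formal solution $u=\sum_{j\ge0}\varepsilon^ju_j\big(\tfrac{\varphi(X,T)}{\varepsilon};X,T\big)$, $\varphi=\sum_{j\ge0}\varepsilon^j\varphi_j(X,T)$, with $u_j(y;X,T)$, $\varphi_j(X,T)$ smooth and $u_j$ $1$-periodic in $y$. Set $k_0=\partial_X\varphi_0$ and suppose that $u_0(y;X,T)=U_0:=U(y;k_0,M_0,p_0)$ and $\partial_T\varphi_0=-k_0\,c(k_0,M_0,p_0)$ for smooth functions $M_0,p_0$ of $(X,T)$, where $U(\cdot\,;k,M,p)$, $c(k,M,p)$ is the three-parameter family of periodic travelling waves of the Korteweg-de Vries equation described in the context (so that $(\ast)$ holds at order $\varepsilon^{-1}$). If $(\ast)$ holds at order $\varepsilon^0$, then $(k_0,M_0,p_0)$ satisfies $$\partial_Tk_0+\partial_X\big(k_0\,c(k_0,M_0,p_0)\big)=0,\qquad\partial_TM_0+\partial_X\langle3U_0^2\rangle=0,$$ $$\tfrac12\,\partial_T\langle U_0^2\rangle+\partial_X\big\langle2U_0^3-\tfrac32k_0^2(U_0')^2\big\rangle=\bar\delta\,k_0^2\big\langle(U_0')^2-k_0^2(U_0'')^2\big\rangle .$$ Conversely, if $k_0=\partial_X\varphi_0$, $\partial_T\varphi_0=-k_0c(k_0,M_0,p_0)$,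 $u_0=U_0$ and these equations hold, then for every $\varphi_1$ the order-$\varepsilon^0$ equation has a solution $u_1$ that is $1$-periodic in $y$. When $\bar\delta>0$, the constant solutions $(k_0,M_0,p_0)$ of this system are exactly the constants with $\langle(U_0')^2\rangle=k_0^2\langle(U_0'')^2\rangle$.
   Context: $\langle f\rangle=\int_0^1 f(y)\,dy$ for $1$-periodic $f$; primes on $U_0$ denote $\partial_y$. Formal solution: one substitutes $u=\sum_j\varepsilon^ju_j(y;X,T)$, replaces $\partial_X$ by $\partial_X+\varepsilon^{-1}(\partial_X\varphi)\partial_y$ and $\partial_T$ by $\partial_T+\varepsilon^{-1}(\partial_T\varphi)\partial_y$, and requires the resulting formal Laurent series in $\varepsilon$ to vanish for all $(y,X,T)$; "holds at order $\varepsilon^n$" means the coefficient of $\varepsilon^n$ vanishes. KdV family: for $k>0$, $M\in\mathbb{R}$, $p\in(0,1)$, $U(y;k,M,p)=M+\tilde U(y;k,p)$ and $c(k,M,p)=6M+\tilde c(k,p)$ with $$\tilde U(y;k,p)=8K(p)^2k^2\Big(\mathrm{dn}^2(2K(p)y)-\tfrac{E(p)}{K(p)}\Big),\qquad\tilde c(k,p)=16K(p)^2k^2\Big(2-p^2-3\tfrac{E(p)}{K(p)}\Big),$$ where $K,E$ are the complete elliptic integrals of first and second kind and $\mathrm{dn}$ is Jacobi's delta amplitude function, all of modulus $p$. These satisfy $-kcU'+6kUU'+k^3U'''=0$, $\langle U\rangle=M$. On $1$-periodic functions the operator $\tilde{\mathcal L}f=k((6\tilde U-\tilde c)f)'+k^3f'''$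 is Fredholm of index $0$ and the kernel of its adjoint is spanned by $1$ and $U$. *)

theory Defs
  imports
    "HOL-Analysis.Analysis"
    "HOL-Computational_Algebra.Formal_Laurent_Series"
begin

section \<open>Smooth functions, partial derivatives, averages\<close>

text \<open>Only meaningful for open sets \<open>S\<close>.\<close>

fun Ck_on :: "nat \<Rightarrow> 'a::real_normed_vector set \<Rightarrow> ('a \<Rightarrow> real) \<Rightarrow> bool" where
  "Ck_on 0 S f \<longleftrightarrow> continuous_on S f"
| "Ck_on (Suc n) S f \<longleftrightarrow>
     (\<forall>x\<in>S. f differentiable (at x)) \<and>
     (\<forall>v. Ck_on n S (\<lambda>x. frechet_derivative f (at x) v))"

definition smooth_on :: "'a::real_normed_vector set \<Rightarrow> ('a \<Rightarrow> real) \<Rightarrow> bool" where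
  "smooth_on S f \<longleftrightarrow> (\<forall>n. Ck_on n S f)"

text \<open>Slow variables are pairs \<open>(X, T)\<close>; functions of the fast and the slow variables
  take \<open>(y, X, T)\<close>, that is, a pair of \<open>y\<close> and a slow point.\<close>

type_synonym slow = "real \<times> real"

definition pd_X :: "(slow \<Rightarrow> real) \<Rightarrow> slow \<Rightarrow> real" where
  "pd_X f = (\<lambda>(X, T). deriv (\<lambda>s. f (s, T)) X)"

definition pd_T :: "(slow \<Rightarrow> real) \<Rightarrow> slow \<Rightarrow> real" where
  "pd_T f = (\<lambda>(X, T). deriv (\<lambda>s. f (X, s)) T)"

definition pd_y :: "(real \<times> slow \<Rightarrow> real) \<Rightarrow> real \<times> slow \<Rightarrow> real" where
  "pd_y f = (\<lambda>(y, x). deriv (\<lambda>s. f (s, x)) y)"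

definition at_fixed_y ::
    "((slow \<Rightarrow> real) \<Rightarrow> slow \<Rightarrow> real) \<Rightarrow> (real \<times> slow \<Rightarrow> real) \<Rightarrow> real \<times> slow \<Rightarrow> real" where
  "at_fixed_y d f = (\<lambda>(y, x). d (\<lambda>x'. f (y, x')) x)"

definition mean :: "(real \<Rightarrow> real) \<Rightarrow> real" where
  "mean f = integral {0..1} f"

section \<open>The periodic travelling waves of KdV\<close>

text \<open>All elliptic integrals and functions take the modulus \<open>p\<close> (not the parameter
  \<open>m = p\<^sup>2\<close>) as last argument.\<close>

definition ellF :: "real \<Rightarrow> real \<Rightarrow> real" where
  "ellF \<phi> p = (LBINT \<theta>=ereal 0..ereal \<phi>. 1 / sqrt (1 - p\<^sup>2 * (sin \<theta>)\<^sup>2))"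

definition ellK :: "real \<Rightarrow> real" where
  "ellK p = ellF (pi / 2) p"

definition ellE :: "real \<Rightarrow> real" where
  "ellE p = (LBINT \<theta>=ereal 0..ereal (pi / 2). sqrt (1 - p\<^sup>2 * (sin \<theta>)\<^sup>2))"

definition jacobi_am :: "real \<Rightarrow> real \<Rightarrow> real" where
  "jacobi_am x p = (THE \<phi>. ellF \<phi> p = x)"

definition jacobi_dn :: "real \<Rightarrow> real \<Rightarrow> real" where
  "jacobi_dn x p = sqrt (1 - p\<^sup>2 * (sin (jacobi_am x p))\<^sup>2)"

definition kdv_U_tilde :: "real \<Rightarrow> real \<Rightarrow> real \<Rightarrow> real" where
  "kdv_U_tilde y k p =
     8 * (ellK p)\<^sup>2 * k\<^sup>2 * ((jacobi_dn (2 * ellK p * y) p)\<^sup>2 - ellE p / ellK p)"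

definition kdv_c_tilde :: "real \<Rightarrow> real \<Rightarrow> real" where
  "kdv_c_tilde k p = 16 * (ellK p)\<^sup>2 * k\<^sup>2 * (2 - p\<^sup>2 - 3 * (ellE p / ellK p))"

definition kdv_U :: "real \<Rightarrow> real \<Rightarrow> real \<Rightarrow> real \<Rightarrow> real" where
  "kdv_U y k M p = M + kdv_U_tilde y k p"

definition kdv_c :: "real \<Rightarrow> real \<Rightarrow> real \<Rightarrow> real" where
  "kdv_c k M p = 6 * M + kdv_c_tilde k p"

section \<open>Formal expansions in \<open>\<epsilon>\<close>\<close>

text \<open>A formal Laurent series in \<open>\<epsilon>\<close> whose coefficients are functions is represented by
  the function that maps each point to the series of values; \<open>\<epsilon>\<close> is \<^const>\<open>fls_X\<close>.\<close>

definition eps_series :: "(nat \<Rightarrow> 'a \<Rightarrow> real) \<Rightarrow> 'a \<Rightarrow> real fls" where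
  "eps_series a = (\<lambda>z. fps_to_fls (Abs_fps (\<lambda>j. a j z)))"

text \<open>The use of \<^const>\<open>Abs_fls\<close> is legitimate as long as the orders of the series \<open>F z\<close>
  are bounded below uniformly in \<open>z\<close> and \<open>d\<close> maps the zero function to itself; this is so
  for everything built below.\<close>

definition coeffwise ::
    "(('a \<Rightarrow> real) \<Rightarrow> 'a \<Rightarrow> real) \<Rightarrow> ('a \<Rightarrow> real fls) \<Rightarrow> 'a \<Rightarrow> real fls" where
  "coeffwise d F = (\<lambda>z. Abs_fls (\<lambda>n. d (\<lambda>w. fls_nth (F w) n) z))"

text \<open>For \<open>d\<close> one of \<open>\<partial>\<^sub>X\<close>, \<open>\<partial>\<^sub>T\<close>: the operator \<open>d + \<epsilon>\<^sup>-\<^sup>1 (d \<phi>) \<partial>\<^sub>y\<close>.\<close>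

definition multiscale ::
    "((slow \<Rightarrow> real) \<Rightarrow> slow \<Rightarrow> real) \<Rightarrow> (nat \<Rightarrow> slow \<Rightarrow> real) \<Rightarrow>
     (real \<times> slow \<Rightarrow> real fls) \<Rightarrow> real \<times> slow \<Rightarrow> real fls" where
  "multiscale d \<phi> F = (\<lambda>(y, x).
     coeffwise (at_fixed_y d) F (y, x)
     + fls_X_inv * eps_series (\<lambda>j. d (\<phi> j)) x * coeffwise pd_y F (y, x))"

definition residual ::
    "real \<Rightarrow> (nat \<Rightarrow> slow \<Rightarrow> real) \<Rightarrow> (nat \<Rightarrow> real \<times> slow \<Rightarrow> real) \<Rightarrow> real \<times> slow \<Rightarrow> real fls" where
  "residual \<delta> \<phi> u = (let v = eps_series u; DX = multiscale pd_X \<phi>; DT = multiscale pd_T \<phi> in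
     (\<lambda>z. DT v z + 6 * v z * DX v z + fls_X ^ 2 * (DX ^^ 3) v z
        + fls_const \<delta> * (fls_X ^ 2 * (DX ^^ 2) v z + fls_X ^ 4 * (DX ^^ 4) v z)))"

definition holds_at_order ::
    "real \<Rightarrow> slow set \<Rightarrow> (nat \<Rightarrow> slow \<Rightarrow> real) \<Rightarrow> (nat \<Rightarrow> real \<times> slow \<Rightarrow> real) \<Rightarrow> int \<Rightarrow> bool" where
  "holds_at_order \<delta> D \<phi> u n \<longleftrightarrow> (\<forall>y. \<forall>x\<in>D. fls_nth (residual \<delta> \<phi> u (y, x)) n = 0)"

definition smooth_profile :: "slow set \<Rightarrow> (real \<times> slow \<Rightarrow> real) \<Rightarrow> bool" where
  "smooth_profile D f \<longleftrightarrow>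
     smooth_on (UNIV \<times> D) f \<and> (\<forall>y. \<forall>x\<in>D. f (y + 1, x) = f (y, x))"

definition formal_ansatz ::
    "slow set \<Rightarrow> (nat \<Rightarrow> slow \<Rightarrow> real) \<Rightarrow> (nat \<Rightarrow> real \<times> slow \<Rightarrow> real) \<Rightarrow> bool" where
  "formal_ansatz D \<phi> u \<longleftrightarrow> (\<forall>j. smooth_on D (\<phi> j) \<and> smooth_profile D (u j))"

section \<open>Modulated waves and the modulation system\<close>

definition wave_profile ::
    "(slow \<Rightarrow> real) \<Rightarrow> (slow \<Rightarrow> real) \<Rightarrow> (slow \<Rightarrow> real) \<Rightarrow> real \<times> slow \<Rightarrow> real" where
  "wave_profile k M p = (\<lambda>(y, x). kdv_U y (k x) (M x) (p x))"

definition modulated_wave ::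
    "slow set \<Rightarrow> (slow \<Rightarrow> real) \<Rightarrow> (real \<times> slow \<Rightarrow> real) \<Rightarrow>
     (slow \<Rightarrow> real) \<Rightarrow> (slow \<Rightarrow> real) \<Rightarrow> (slow \<Rightarrow> real) \<Rightarrow> bool" where
  "modulated_wave D \<phi>0 u0 k0 M0 p0 \<longleftrightarrow>
     smooth_on D M0 \<and> smooth_on D p0 \<and>
     (\<forall>x\<in>D. k0 x = pd_X \<phi>0 x \<and> k0 x > 0 \<and> p0 x \<in> {0<..<1} \<and>
        pd_T \<phi>0 x = - k0 x * kdv_c (k0 x) (M0 x) (p0 x) \<and>
        (\<forall>y. u0 (y, x) = wave_profile k0 M0 p0 (y, x)))"

definition modulation_system ::
    "real \<Rightarrow> slow set \<Rightarrow> (slow \<Rightarrow> real) \<Rightarrow> (slow \<Rightarrow> real) \<Rightarrow> (slow \<Rightarrow> real) \<Rightarrow> bool" where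
  "modulation_system \<delta> D k0 M0 p0 \<longleftrightarrow>
    (let U0 = wave_profile k0 M0 p0; U0' = pd_y U0; U0'' = pd_y U0' in
     \<forall>x\<in>D.
       pd_T k0 x + pd_X (\<lambda>x. k0 x * kdv_c (k0 x) (M0 x) (p0 x)) x = 0 \<and>
       pd_T M0 x + pd_X (\<lambda>x. mean (\<lambda>y. 3 * (U0 (y, x))\<^sup>2)) x = 0 \<and>
       1 / 2 * pd_T (\<lambda>x. mean (\<lambda>y. (U0 (y, x))\<^sup>2)) x
         + pd_X (\<lambda>x. mean (\<lambda>y. 2 * U0 (y, x) ^ 3 - 3 / 2 * (k0 x)\<^sup>2 * (U0' (y, x))\<^sup>2)) x
       = \<delta> * (k0 x)\<^sup>2 * mean (\<lambda>y. (U0' (y, x))\<^sup>2 - (k0 x)\<^sup>2 * (U0'' (y, x))\<^sup>2))"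

end

theory Submission
  imports Defs
begin

text \<open>Averaging the order-\<open>\<epsilon>\<^sup>0\<close> equation against \<open>1\<close> and \<open>U\<^sub>0\<close> turns everything except the modulation
  equations into \<open>y\<close>-derivatives of periodic functions; the conservation of waves is the equality
  of mixed derivatives of \<open>\<phi>\<^sub>0\<close>. Conversely the equation for \<open>u\<^sub>1\<close> is integrated once in \<open>y\<close> and becomes
  \<open>k\<^sup>2 v'' + 6 V v = h\<close> with \<open>V = U\<^sub>0 - c/6\<close>, which satisfies \<open>k\<^sup>2 V'\<^sup>2 = - 2 V\<^sup>3 + 2 A V + B\<close>. Both solutions
  \<open>V'\<close> and \<open>w\<close> of the homogeneous equation are explicit, with \<open>w(y + 1) = w(y) + \<alpha> V'(y)\<close>, so variation of
  constants gives a solution that depends smoothly on all variables, and adding a multiple of \<open>w\<close>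
  makes it periodic as soon as \<open>\<alpha> \<noteq> 0\<close>. This last condition amounts to a lower bound for \<open>E/K\<close>, which follows
  from \<open>E \<ge> sqrt (1 - p\<^sup>2) K\<close>.\<close>

section \<open>Calculus of \<open>Ck_on\<close> and \<open>smooth_on\<close>\<close>

text \<open>The corrector must be smooth in \<open>(y, X, T)\<close> jointly, so solvability at each
  slow point separately (the Fredholm alternative) would not suffice; hence a closed formula made of
  smooth ingredients, arithmetic and primitives. For the same reason smooth dependence of
  \<open>ellK\<close>, \<open>ellE\<close> and \<open>jacobi_dn\<close> on the modulus is never
  established: the elliptic formulas are used at one slow point at a time, and what must vary
  smoothly (\<open>c\<close>, \<open>A\<close>, \<open>B\<close>) is recovered from
  \<open>\<phi> 0\<close> and \<open>u 0\<close>, which are smooth by assumption. In terms of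
  \<open>dn^2\<close> the cubic \<open>- 2 V^3 + 2 A V + B\<close> has the distinct roots
  \<open>0\<close>, \<open>q\<close>, \<open>1\<close> with \<open>q = 1 - p^2\<close>, so the
  Wronskian of \<open>V'\<close> and \<open>w\<close> does not vanish. Up to a positive factor,
  \<alpha> is \<open>2 (1 - q + q^2) E/K - q (1 + q)\<close>. This tends to 0 as \<open>p\<close>
  does, so the bound on \<open>E/K\<close> has to be accurate to first order in \<open>p^2\<close>
  there; \<open>sqrt q\<close> is, the cruder \<open>q\<close> is not. The two averages of the
  order-zero equation do not see the corrector, so they serve both directions.\<close>

lemma Ck_on_cong:
  assumes "open S" and "\<And>x. x \<in> S \<Longrightarrow> f x = g x"
  shows "Ck_on n S f \<longleftrightarrow> Ck_on n S g"
  using assms(2)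
proof (induction n arbitrary: f g)
  case 0
  then show ?case by (simp cong: continuous_on_cong)
next
  case (Suc n)
  have D: "(f has_derivative f') (at x) \<longleftrightarrow> (g has_derivative f') (at x)" if "x \<in> S" for x f'
    using has_derivative_transform_within_open[OF _ \<open>open S\<close> that, of f f' UNIV g]
      has_derivative_transform_within_open[OF _ \<open>open S\<close> that, of g f' UNIV f] Suc.prems
    by auto
  then have "frechet_derivative f (at x) = frechet_derivative g (at x)" if "x \<in> S" for x
    using that by (simp add: frechet_derivative_def)
  then have "Ck_on n S (\<lambda>x. frechet_derivative f (at x) v)
      \<longleftrightarrow> Ck_on n S (\<lambda>x. frechet_derivative g (at x) v)" for v
    by (intro Suc.IH) simp
  with D show ?case by (auto simp: differentiable_def)
qed

text \<open>\<open>frechet_derivative\<close> is a choice term; uniqueness of derivatives lets the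
  closure proofs below supply an explicit derivative instead.\<close>

lemma Ck_on_SucI:
  assumes "open S" and "\<And>x. x \<in> S \<Longrightarrow> (f has_derivative f' x) (at x)"
    and "\<And>v. Ck_on n S (\<lambda>x. f' x v)"
  shows "Ck_on (Suc n) S f"
proof -
  have "frechet_derivative f (at x) = f' x" if "x \<in> S" for x
    using frechet_derivative_at[OF assms(2)[OF that]] by simp
  then have "Ck_on n S (\<lambda>x. frechet_derivative f (at x) v)" for v
    using assms(3)[of v] by (subst Ck_on_cong[OF \<open>open S\<close>]) auto
  with assms(2) show ?thesis by (auto simp: differentiable_def)
qed

lemma Ck_on_SucD:
  assumes "Ck_on (Suc n) S f" and "x \<in> S"
  shows "(f has_derivative frechet_derivative f (at x)) (at x)"
  using assms by (simp flip: frechet_derivative_works)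

lemma Ck_on_Suc_imp: "Ck_on (Suc n) S f \<Longrightarrow> Ck_on n S f"
proof (induction n arbitrary: f)
  case 0
  then show ?case
    by (auto intro!: continuous_at_imp_continuous_on differentiable_imp_continuous_within)
next
  case (Suc n)
  then show ?case by (metis Ck_on.simps(2))
qed

lemma Ck_on_imp_continuous_on: "Ck_on n S f \<Longrightarrow> continuous_on S f"
proof (induction n)
  case 0
  then show ?case by simp
qed (blast dest: Ck_on_Suc_imp)

lemma Ck_on_const: "open S \<Longrightarrow> Ck_on n S (\<lambda>_. c)"
proof (induction n arbitrary: c)
  case (Suc n)
  then show ?case by (intro Ck_on_SucI[where f' = "\<lambda>_ _. 0"]) auto
qed simp

lemma Ck_on_bounded_linear:
  assumes "open S" "bounded_linear f"
  shows "Ck_on n S f"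
proof (cases n)
  case 0
  then show ?thesis using assms by (simp add: linear_continuous_on)
next
  case (Suc m)
  have "Ck_on (Suc m) S f"
    using assms by (intro Ck_on_SucI[where f' = "\<lambda>_. f"])
      (auto intro: Ck_on_const bounded_linear_imp_has_derivative)
  with Suc show ?thesis by simp
qed

lemma Ck_on_add:
  assumes "open S" "Ck_on n S f" "Ck_on n S g"
  shows "Ck_on n S (\<lambda>x. f x + g x)"
  using assms(2,3)
proof (induction n arbitrary: f g)
  case 0
  then show ?case by (simp add: continuous_on_add)
next
  case (Suc n)
  show ?case
    by (rule Ck_on_SucI[OF \<open>open S\<close> has_derivative_add[OF Suc.prems[THEN Ck_on_SucD]]])
      (use Suc in auto)
qed

lemma Ck_on_sum:
  assumes "open S" "\<And>i. i \<in> I \<Longrightarrow> Ck_on n S (f i)"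
  shows "Ck_on n S (\<lambda>x. \<Sum>i\<in>I. f i x)"
  using assms(2)
  by (induction I rule: infinite_finite_induct)
    (auto simp: Ck_on_const \<open>open S\<close> intro!: Ck_on_add)

lemma Ck_on_mult:
  assumes "open S" "Ck_on n S f" "Ck_on n S g"
  shows "Ck_on n S (\<lambda>x. f x * g x)"
  using assms(2,3)
proof (induction n arbitrary: f g)
  case 0
  then show ?case by (simp add: continuous_on_mult)
next
  case (Suc n)
  have "Ck_on n S f" "Ck_on n S g" "\<And>v. Ck_on n S (\<lambda>x. frechet_derivative f (at x) v)"
    "\<And>v. Ck_on n S (\<lambda>x. frechet_derivative g (at x) v)"
    using Suc.prems Suc.prems[THEN Ck_on_Suc_imp] by simp_all
  then have "Ck_on n S (\<lambda>x. f x * frechet_derivative g (at x) v + frechet_derivative f (at x) v * g x)" for v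
    by (intro Ck_on_add \<open>open S\<close> Suc.IH)
  then show ?case
    by (intro Ck_on_SucI[OF \<open>open S\<close> has_derivative_mult[OF Suc.prems[THEN Ck_on_SucD]]])
qed

lemma Ck_on_inverse:
  assumes "open S" "Ck_on n S f" "\<And>x. x \<in> S \<Longrightarrow> f x \<noteq> 0"
  shows "Ck_on n S (\<lambda>x. inverse (f x))"
  using assms(2)
proof (induction n)
  case 0
  then show ?case using assms(3) by (auto intro: continuous_on_inverse)
next
  case (Suc n)
  have 1: "Ck_on n S (\<lambda>x. inverse (f x))" by (rule Suc.IH[OF Ck_on_Suc_imp[OF Suc.prems]])
  have 2: "Ck_on n S (\<lambda>x. frechet_derivative f (at x) v)" for v using Suc.prems by simp
  have 3: "Ck_on n S (\<lambda>x. - 1 * (inverse (f x) * frechet_derivative f (at x) v * inverse (f x)))" for v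
    by (intro Ck_on_mult Ck_on_const 1 2 assms(1))
  show ?case
    by (rule Ck_on_SucI[OF \<open>open S\<close> Deriv.has_derivative_inverse[OF assms(3) Suc.prems[THEN Ck_on_SucD]]])
      (use 3 in auto)
qed

text \<open>\<open>Ck_on\<close> speaks of real-valued functions only, so the regularity of
  \<open>g\<close> is stated through its components. By the chain rule a derivative of the composite
  is a sum of products of derivatives of these components with partial derivatives of
  \<open>f\<close> composed with the same \<open>g\<close>; hence the induction varies
  \<open>f\<close> and keeps \<open>g\<close>.\<close>

lemma Ck_on_compose:
  fixes f :: "'b::euclidean_space \<Rightarrow> real" and g :: "'a::real_normed_vector \<Rightarrow> 'b"
  assumes "open S" "open T" "Ck_on n T f" "\<And>b. b \<in> Basis \<Longrightarrow> Ck_on n S (\<lambda>x. g x \<bullet> b)"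
    and "\<And>x. x \<in> S \<Longrightarrow> g x \<in> T"
  shows "Ck_on n S (\<lambda>x. f (g x))"
  using assms(3,4)
proof (induction n arbitrary: f)
  case 0
  then have "continuous_on S g" by (simp add: continuous_on_componentwise[of S g])
  with 0 show ?case using assms(5) by (auto intro: continuous_on_compose2)
next
  case (Suc n)
  define g' where "g' x v = (\<Sum>b\<in>Basis. frechet_derivative (\<lambda>x. g x \<bullet> b) (at x) v *\<^sub>R b)" for x v
  have "(g has_derivative g' x) (at x)" if "x \<in> S" for x
    unfolding has_derivative_componentwise_within[of g "g' x"] g'_def
    using Ck_on_SucD[OF Suc.prems(2) that] by simp
  then have D: "((\<lambda>x. f (g x)) has_derivative (\<lambda>v. frechet_derivative f (at (g x)) (g' x v))) (at x)"
    if "x \<in> S" for x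
    using that has_derivative_compose[of g "g' x" x UNIV f "frechet_derivative f (at (g x))"]
      Ck_on_SucD[OF Suc.prems(1) assms(5)[OF that]] by simp
  have *: "frechet_derivative f (at (g x)) (g' x v)
      = (\<Sum>b\<in>Basis. frechet_derivative (\<lambda>x. g x \<bullet> b) (at x) v * frechet_derivative f (at (g x)) b)"
    if "x \<in> S" for x v
  proof -
    have "linear (frechet_derivative f (at (g x)))"
      using Ck_on_SucD[OF Suc.prems(1) assms(5)[OF that]] has_derivative_linear by blast
    then show ?thesis by (simp add: g'_def linear_sum linear_scale)
  qed
  have "Ck_on n S (\<lambda>x. \<Sum>b\<in>Basis. frechet_derivative (\<lambda>x. g x \<bullet> b) (at x) v * frechet_derivative f (at (g x)) b)" for v
  proof (rule Ck_on_sum[OF assms(1)], rule Ck_on_mult[OF assms(1) _ Suc.IH])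
    fix b :: 'b assume b: "b \<in> Basis"
    show "Ck_on n S (\<lambda>x. frechet_derivative (\<lambda>x. g x \<bullet> b) (at x) v)"
      using Suc.prems(2)[OF b] by simp
    show "Ck_on n T (\<lambda>x. frechet_derivative f (at x) b)" using Suc.prems(1) by simp
    show "\<And>b. b \<in> Basis \<Longrightarrow> Ck_on n S (\<lambda>x. g x \<bullet> b)"
      by (rule Suc.prems(2)[THEN Ck_on_Suc_imp])
  qed
  then have "Ck_on n S (\<lambda>x. frechet_derivative f (at (g x)) (g' x v))" for v
    by (subst Ck_on_cong[OF assms(1) *])
  with D show ?case by (intro Ck_on_SucI[OF assms(1)])
qed

section \<open>Differentiation under the integral sign\<close>

text \<open>The Leibniz rule wants the derivative as a continuous family of bounded linear maps,
  whereas \<open>Ck_on\<close> offers continuity direction by direction; in a Euclidean space the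
  second gives the first componentwise.\<close>

lemma has_derivative_parametric_integral:
  fixes f :: "real \<times> 'a::euclidean_space \<Rightarrow> real"
  assumes "open S" "Ck_on (Suc 0) (UNIV \<times> S) f" "x \<in> S"
  shows "((\<lambda>x. integral {0..1} (\<lambda>s. f (s, x))) has_derivative
        (\<lambda>v. integral {0..1} (\<lambda>s. frechet_derivative f (at (s, x)) (0, v)))) (at x)"
proof -
  obtain e where e: "e > 0" "ball x e \<subseteq> S" using assms openE by blast
  have Df: "(f has_derivative frechet_derivative f (at (s, z))) (at (s, z))" if "z \<in> S" for s z
    using Ck_on_SucD[OF assms(2)] that by simp
  define fx where "fx z s = Blinfun (\<lambda>v. frechet_derivative f (at (s, z)) (0, v))" for z s
  have Dz: "((\<lambda>z. f (s, z)) has_derivative (\<lambda>v. frechet_derivative f (at (s, z)) (0, v))) (at z)"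
    if "z \<in> S" for s z
    by (rule has_derivative_compose[where f = "Pair s" and g = f and f' = "Pair 0",
        OF has_derivative_Pair[OF has_derivative_const has_derivative_ident] Df[OF that]])
  have fx: "blinfun_apply (fx z s) = (\<lambda>v. frechet_derivative f (at (s, z)) (0, v))"
    if "z \<in> S" for s z
    unfolding fx_def using has_derivative_bounded_linear[OF Dz[OF that]]
    by (rule bounded_linear_Blinfun_apply)
  have cf: "continuous_on (UNIV \<times> S) f" by (rule Ck_on_imp_continuous_on[OF assms(2)])
  have cd: "continuous_on (UNIV \<times> S) (\<lambda>x. frechet_derivative f (at x) v)" for v
    using assms(2) by (cases v) simp
  have cfx: "continuous_on (ball x e \<times> cbox 0 1) (\<lambda>(z, s). fx z s)"
  proof (rule continuous_on_blinfun_componentwise)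
    fix i :: 'a
    have "continuous_on (ball x e \<times> cbox 0 (1::real)) (\<lambda>zs. frechet_derivative f (at (snd zs, fst zs)) (0, i))"
      by (rule continuous_on_compose2[OF cd]) (use e in \<open>auto intro!: continuous_intros\<close>)
    then show "continuous_on (ball x e \<times> cbox 0 1) (\<lambda>zs. blinfun_apply (case zs of (z, s) \<Rightarrow> fx z s) i)"
      by (rule continuous_on_eq) (use e fx in auto)
  qed
  have "((\<lambda>z. integral (cbox 0 1) ((\<lambda>z s. f (s, z)) z)) has_derivative
      integral (cbox 0 1) (fx x)) (at x within ball x e)"
  proof (rule leibniz_rule)
    show "((\<lambda>z. f (s, z)) has_derivative blinfun_apply (fx z s)) (at z within ball x e)"
      if "z \<in> ball x e" for z s
    proof -
      have "z \<in> S" using that e by blast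
      then show ?thesis using Dz[of z s] fx[of z s] has_derivative_at_withinI by simp
    qed
    show "(\<lambda>s. f (s, z)) integrable_on cbox 0 1" if "z \<in> ball x e" for z
      by (intro integrable_continuous continuous_on_compose2[OF cf])
        (use e that in \<open>auto intro!: continuous_intros\<close>)
  qed (use e cfx in auto)
  then have "((\<lambda>z. integral {0..1} (\<lambda>s. f (s, z))) has_derivative integral (cbox 0 1) (fx x)) (at x)"
    using e by (simp add: at_within_open[of x "ball x e"])
  moreover have "blinfun_apply (integral (cbox 0 1) (fx x)) v
      = integral {0..1} (\<lambda>s. frechet_derivative f (at (s, x)) (0, v))" for v
  proof -
    have "Pair x ` cbox 0 1 \<subseteq> ball x e \<times> cbox 0 (1::real)" using e by auto
    from continuous_on_compose2[OF cfx continuous_on_Pair[OF continuous_on_const continuous_on_id] this]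
    have "continuous_on (cbox 0 1) (fx x)" by simp
    then have "blinfun_apply (integral (cbox 0 1) (fx x)) v = integral (cbox 0 1) (\<lambda>s. blinfun_apply (fx x s) v)"
      by (intro blinfun_apply_integral integrable_continuous)
    then show ?thesis by (simp add: fx[OF assms(3)])
  qed
  ultimately show ?thesis by (metis (no_types, lifting) ext)
qed

lemma Ck_on_parametric_integral:
  fixes f :: "real \<times> 'a::euclidean_space \<Rightarrow> real"
  assumes "open S" "Ck_on n (UNIV \<times> S) f"
  shows "Ck_on n S (\<lambda>x. integral {0..1} (\<lambda>s. f (s, x)))"
  using assms(2)
proof (induction n arbitrary: f)
  case 0
  then have c: "continuous_on (UNIV \<times> S) f" by simp
  have "continuous_on (S \<times> cbox 0 1) (\<lambda>zs. f (snd zs, fst zs))"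
    by (rule continuous_on_compose2[OF c]) (auto intro!: continuous_intros)
  then show ?case
    using integral_continuous_on_param[of S 0 "1::real" "\<lambda>z s. f (s, z)"] by (simp add: split_beta)
next
  case (Suc n)
  have "Ck_on (Suc 0) (UNIV \<times> S) f"
    using Suc.prems Ck_on_imp_continuous_on by (metis Ck_on.simps)
  then show ?case
    by (intro Ck_on_SucI[OF assms(1) has_derivative_parametric_integral[OF assms(1)]])
      (use Suc in auto)
qed

section \<open>Symmetry of second derivatives\<close>

text \<open>Two applications of the mean value theorem, along \<open>v\<close> and along
  \<open>w\<close>. The double difference is symmetric in \<open>v\<close> and \<open>w\<close>,
  which makes the two mixed derivatives comparable.\<close>

lemma second_difference_mvt:
  fixes f :: "'a::real_normed_vector \<Rightarrow> real"
  assumes "Ck_on 2 S f" "h > 0"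
    and S: "\<And>s t. 0 \<le> s \<Longrightarrow> s \<le> h \<Longrightarrow> 0 \<le> t \<Longrightarrow> t \<le> h \<Longrightarrow> x + s *\<^sub>R v + t *\<^sub>R w \<in> S"
  shows "\<exists>s t. 0 < s \<and> s < h \<and> 0 < t \<and> t < h \<and>
    f (x + h *\<^sub>R v + h *\<^sub>R w) - f (x + h *\<^sub>R v) - (f (x + h *\<^sub>R w) - f x)
      = h * h * frechet_derivative (\<lambda>x. frechet_derivative f (at x) v) (at (x + s *\<^sub>R v + t *\<^sub>R w)) w"
proof -
  define d where "d = (\<lambda>x. frechet_derivative f (at x) v)"
  have f1: "Ck_on (Suc (Suc 0)) S f" using assms(1) by (simp add: numeral_2_eq_2)
  then have d1: "Ck_on (Suc 0) S d" unfolding d_def by simp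
  have Df: "((\<lambda>s. f (x + s *\<^sub>R v + t *\<^sub>R w)) has_real_derivative d (x + s *\<^sub>R v + t *\<^sub>R w)) (at s)"
    if "0 \<le> s" "s \<le> h" "0 \<le> t" "t \<le> h" for s t
  proof -
    have D: "(f has_derivative frechet_derivative f (at (x + s *\<^sub>R v + t *\<^sub>R w))) (at (x + s *\<^sub>R v + t *\<^sub>R w))"
      by (rule Ck_on_SucD[OF f1 S[OF that]])
    have "((\<lambda>s. f (x + s *\<^sub>R v + t *\<^sub>R w)) has_derivative
        (\<lambda>r. frechet_derivative f (at (x + s *\<^sub>R v + t *\<^sub>R w)) (r *\<^sub>R v))) (at s)"
      by (rule has_derivative_compose[where f = "\<lambda>s. x + s *\<^sub>R v + t *\<^sub>R w" and g = f, OF _ D])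
        (auto intro!: derivative_eq_intros)
    also have "(\<lambda>r. frechet_derivative f (at (x + s *\<^sub>R v + t *\<^sub>R w)) (r *\<^sub>R v)) = (*) (d (x + s *\<^sub>R v + t *\<^sub>R w))"
      using linear_scale[OF has_derivative_linear[OF D]] by (simp add: fun_eq_iff d_def)
    finally show ?thesis by (simp only: has_field_derivative_def)
  qed
  have Dd: "((\<lambda>t. d (x + s *\<^sub>R v + t *\<^sub>R w)) has_real_derivative
      frechet_derivative d (at (x + s *\<^sub>R v + t *\<^sub>R w)) w) (at t)"
    if "0 \<le> s" "s \<le> h" "0 \<le> t" "t \<le> h" for s t
  proof -
    have D: "(d has_derivative frechet_derivative d (at (x + s *\<^sub>R v + t *\<^sub>R w))) (at (x + s *\<^sub>R v + t *\<^sub>R w))"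
      by (rule Ck_on_SucD[OF d1 S[OF that]])
    have "((\<lambda>t. d (x + s *\<^sub>R v + t *\<^sub>R w)) has_derivative
        (\<lambda>r. frechet_derivative d (at (x + s *\<^sub>R v + t *\<^sub>R w)) (r *\<^sub>R w))) (at t)"
      by (rule has_derivative_compose[where f = "\<lambda>t. x + s *\<^sub>R v + t *\<^sub>R w" and g = d, OF _ D])
        (auto intro!: derivative_eq_intros)
    also have "(\<lambda>r. frechet_derivative d (at (x + s *\<^sub>R v + t *\<^sub>R w)) (r *\<^sub>R w))
        = (*) (frechet_derivative d (at (x + s *\<^sub>R v + t *\<^sub>R w)) w)"
      using linear_scale[OF has_derivative_linear[OF D]] by (simp add: fun_eq_iff)
    finally show ?thesis by (simp only: has_field_derivative_def)
  qed
  define g where "g s = f (x + s *\<^sub>R v + h *\<^sub>R w) - f (x + s *\<^sub>R v)" for s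
  have "(g has_real_derivative d (x + s *\<^sub>R v + h *\<^sub>R w) - d (x + s *\<^sub>R v)) (at s)"
    if "0 \<le> s" "s \<le> h" for s
    unfolding g_def using Df[OF that, of h] Df[OF that, of 0] assms(2)
    by (intro DERIV_diff) auto
  from MVT2[OF \<open>h > 0\<close> this]
  obtain s where s: "0 < s" "s < h" "g h - g 0 = h * (d (x + s *\<^sub>R v + h *\<^sub>R w) - d (x + s *\<^sub>R v))"
    by auto
  from MVT2[OF \<open>h > 0\<close> Dd[of s]] s
  obtain t where "0 < t" "t < h" "d (x + s *\<^sub>R v + h *\<^sub>R w) - d (x + s *\<^sub>R v)
      = h * frechet_derivative d (at (x + s *\<^sub>R v + t *\<^sub>R w)) w"
    by auto
  with s show ?thesis
    unfolding g_def d_def by (intro exI[of _ s] exI[of _ t]) auto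
qed

lemma frechet_derivative_commute:
  fixes f :: "'a::real_normed_vector \<Rightarrow> real"
  assumes "open S" "Ck_on 2 S f" "x \<in> S"
  shows "frechet_derivative (\<lambda>x. frechet_derivative f (at x) v) (at x) w
       = frechet_derivative (\<lambda>x. frechet_derivative f (at x) w) (at x) v"
proof (rule ccontr)
  define P where "P v w = (\<lambda>x. frechet_derivative (\<lambda>x. frechet_derivative f (at x) v) (at x) w)" for v w
  assume "\<not> ?thesis"
  \<comment> \<open>Numbers that lie within half the gap of the respective mixed derivatives at
    \<open>x\<close> cannot be equal.\<close>
  then have e: "\<bar>P v w x - P w v x\<bar> / 2 > 0" (is "?e > 0") by (simp add: P_def)
  have "continuous_on S (P a b)" for a b
    using assms(2) by (simp add: P_def numeral_2_eq_2)
  then have "isCont (P a b) x" for a b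
    using assms continuous_on_eq_continuous_at by blast
  then have "\<forall>\<^sub>F z in nhds x. dist (P a b z) (P a b x) < ?e" for a b
    unfolding isCont_def tendsto_at_iff_tendsto_nhds by (rule tendstoD[OF _ e])
  then have "\<forall>\<^sub>F z in nhds x. z \<in> S \<and> dist (P v w z) (P v w x) < ?e \<and> dist (P w v z) (P w v x) < ?e"
    using assms by (intro eventually_conj eventually_nhds_in_open)
  then obtain d where d: "d > 0" "\<And>z. dist z x < d \<Longrightarrow>
      z \<in> S \<and> dist (P v w z) (P v w x) < ?e \<and> dist (P w v z) (P w v x) < ?e"
    unfolding eventually_nhds_metric by blast
  \<comment> \<open>Keeps the parallelogram spanned by \<open>h v\<close> and \<open>h w\<close>
    inside the ball of radius \<open>d\<close>; the summand 1 covers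
    \<open>v = w = 0\<close>.\<close>
  define h where "h = d / (norm v + norm w + 1)"
  have n: "norm v + norm w + 1 > 0" by (simp add: add_nonneg_pos)
  then have h: "h > 0" using d by (simp add: h_def)
  have dist: "dist (x + s *\<^sub>R v + t *\<^sub>R w) x < d" if "0 \<le> s" "s \<le> h" "0 \<le> t" "t \<le> h" for s t
  proof -
    have "dist (x + s *\<^sub>R v + t *\<^sub>R w) x \<le> norm (s *\<^sub>R v) + norm (t *\<^sub>R w)"
      by (simp add: dist_norm add.assoc) (metis norm_scaleR norm_triangle_ineq)
    also have "\<dots> \<le> h * norm v + h * norm w"
      using that by (simp add: add_mono mult_right_mono)
    also have "\<dots> < h * (norm v + norm w + 1)" using h by (simp add: algebra_simps)
    also have "\<dots> = d" using n by (simp add: h_def)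
    finally show ?thesis .
  qed
  have dist': "dist (x + s *\<^sub>R w + t *\<^sub>R v) x < d" if "0 \<le> s" "s \<le> h" "0 \<le> t" "t \<le> h" for s t
    using dist[OF that(3,4,1,2)] by (simp add: add.commute add.left_commute)
  obtain s t where 1: "0 < s" "s < h" "0 < t" "t < h"
    "f (x + h *\<^sub>R v + h *\<^sub>R w) - f (x + h *\<^sub>R v) - (f (x + h *\<^sub>R w) - f x)
      = h * h * P v w (x + s *\<^sub>R v + t *\<^sub>R w)"
    using second_difference_mvt[OF assms(2) h, of x v w] d(2) dist unfolding P_def by blast
  obtain s' t' where 2: "0 < s'" "s' < h" "0 < t'" "t' < h"
    "f (x + h *\<^sub>R w + h *\<^sub>R v) - f (x + h *\<^sub>R w) - (f (x + h *\<^sub>R v) - f x)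
      = h * h * P w v (x + s' *\<^sub>R w + t' *\<^sub>R v)"
    using second_difference_mvt[OF assms(2) h, of x w v] d(2) dist' unfolding P_def by blast
  have "x + h *\<^sub>R w + h *\<^sub>R v = x + h *\<^sub>R v + h *\<^sub>R w" by (simp add: algebra_simps)
  then have "h * h * P v w (x + s *\<^sub>R v + t *\<^sub>R w) = h * h * P w v (x + s' *\<^sub>R w + t' *\<^sub>R v)"
    unfolding 1(5)[symmetric] 2(5)[symmetric] by (simp add: add_ac)
  then have "P v w (x + s *\<^sub>R v + t *\<^sub>R w) = P w v (x + s' *\<^sub>R w + t' *\<^sub>R v)"
    using h by simp
  with d(2)[OF dist, of s t] d(2)[OF dist', of s' t'] 1 2
  show False by (auto simp: dist_real_def abs_if split: if_splits)
qed

subsection \<open>Smooth functions and directional derivatives\<close>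

lemma smooth_on_cong:
  "open S \<Longrightarrow> (\<And>x. x \<in> S \<Longrightarrow> f x = g x) \<Longrightarrow> smooth_on S f \<longleftrightarrow> smooth_on S g"
  unfolding smooth_on_def using Ck_on_cong by blast

lemma smooth_on_const: "open S \<Longrightarrow> smooth_on S (\<lambda>_. c)"
  by (simp add: smooth_on_def Ck_on_const)

lemma smooth_on_bounded_linear: "open S \<Longrightarrow> bounded_linear f \<Longrightarrow> smooth_on S f"
  by (simp add: smooth_on_def Ck_on_bounded_linear)

lemma smooth_on_add: "open S \<Longrightarrow> smooth_on S f \<Longrightarrow> smooth_on S g \<Longrightarrow> smooth_on S (\<lambda>x. f x + g x)"
  by (simp add: smooth_on_def Ck_on_add)

lemma smooth_on_mult: "open S \<Longrightarrow> smooth_on S f \<Longrightarrow> smooth_on S g \<Longrightarrow> smooth_on S (\<lambda>x. f x * g x)"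
  by (simp add: smooth_on_def Ck_on_mult)

lemma smooth_on_minus: "open S \<Longrightarrow> smooth_on S f \<Longrightarrow> smooth_on S (\<lambda>x. - f x)"
  using smooth_on_mult[OF _ smooth_on_const[of S "- 1"], of f] by simp

lemma smooth_on_diff: "open S \<Longrightarrow> smooth_on S f \<Longrightarrow> smooth_on S g \<Longrightarrow> smooth_on S (\<lambda>x. f x - g x)"
  using smooth_on_add[OF _ _ smooth_on_minus, of S f g] by simp

lemma smooth_on_power: "open S \<Longrightarrow> smooth_on S f \<Longrightarrow> smooth_on S (\<lambda>x. f x ^ n)"
  by (induction n) (simp_all add: smooth_on_const smooth_on_mult)

lemma smooth_on_divide:
  "open S \<Longrightarrow> smooth_on S f \<Longrightarrow> smooth_on S g \<Longrightarrow> (\<And>x. x \<in> S \<Longrightarrow> g x \<noteq> 0) \<Longrightarrow> smooth_on S (\<lambda>x. f x / g x)"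
  by (simp add: smooth_on_def divide_inverse Ck_on_mult Ck_on_inverse)

lemma smooth_on_compose:
  fixes f :: "'b::euclidean_space \<Rightarrow> real" and g :: "'a::real_normed_vector \<Rightarrow> 'b"
  assumes "open S" "open T" "smooth_on T f" "\<And>b. b \<in> Basis \<Longrightarrow> smooth_on S (\<lambda>x. g x \<bullet> b)"
    and "\<And>x. x \<in> S \<Longrightarrow> g x \<in> T"
  shows "smooth_on S (\<lambda>x. f (g x))"
  using assms Ck_on_compose[of S T _ f g] by (simp add: smooth_on_def)

lemma smooth_on_parametric_integral:
  fixes f :: "real \<times> 'a::euclidean_space \<Rightarrow> real"
  shows "open S \<Longrightarrow> smooth_on (UNIV \<times> S) f \<Longrightarrow> smooth_on S (\<lambda>x. integral {0..1} (\<lambda>s. f (s, x)))"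
  by (simp add: smooth_on_def Ck_on_parametric_integral)

lemma smooth_on_has_derivative:
  "smooth_on S f \<Longrightarrow> x \<in> S \<Longrightarrow> (f has_derivative frechet_derivative f (at x)) (at x)"
  unfolding smooth_on_def using Ck_on_SucD by blast

lemma smooth_on_differentiable: "smooth_on S f \<Longrightarrow> x \<in> S \<Longrightarrow> f differentiable (at x)"
  using smooth_on_has_derivative differentiable_def by blast

lemma smooth_on_frechet_derivative: "smooth_on S f \<Longrightarrow> smooth_on S (\<lambda>x. frechet_derivative f (at x) v)"
  unfolding smooth_on_def by (metis Ck_on.simps(2))

text \<open>Covers \<open>\<partial>\<^sub>X\<close>, \<open>\<partial>\<^sub>T\<close>, \<open>\<partial>\<^sub>y\<close> and the slow derivatives at fixed \<open>y\<close> at once.\<close>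

definition directional :: "(('a::real_normed_vector \<Rightarrow> real) \<Rightarrow> 'a \<Rightarrow> real) \<Rightarrow> 'a \<Rightarrow> bool" where
  "directional d v \<longleftrightarrow> (\<forall>f x. f differentiable (at x) \<longrightarrow> d f x = frechet_derivative f (at x) v)"

lemma directionalI:
  assumes "\<And>f x f'. (f has_derivative f') (at x) \<Longrightarrow> d f x = f' v"
  shows "directional d v"
  unfolding directional_def using assms frechet_derivative_works by blast

lemma has_derivative_imp_DERIV_line:
  assumes "(f has_derivative f') (at (g s))" "(g has_vector_derivative v) (at s)"
  shows "((\<lambda>s. f (g s)) has_real_derivative f' v) (at s)"
proof -
  have "(\<lambda>r. f' (r *\<^sub>R v)) = (*) (f' v)"
    using linear_scale[OF has_derivative_linear[OF assms(1)]] by (simp add: fun_eq_iff)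
  with has_derivative_compose[OF assms(2)[unfolded has_vector_derivative_def] assms(1)]
  show ?thesis by (simp add: has_field_derivative_def)
qed

lemma directional_pd_X: "directional pd_X (1, 0)"
proof (rule directionalI)
  fix f :: "slow \<Rightarrow> real" and x f' assume "(f has_derivative f') (at x)"
  then have "((\<lambda>s. f (s, snd x)) has_real_derivative f' (1, 0)) (at (fst x))"
    by (intro has_derivative_imp_DERIV_line) (auto intro!: derivative_eq_intros simp: has_vector_derivative_def)
  then show "pd_X f x = f' (1, 0)" by (simp add: pd_X_def split_beta DERIV_imp_deriv)
qed

lemma directional_pd_T: "directional pd_T (0, 1)"
proof (rule directionalI)
  fix f :: "slow \<Rightarrow> real" and x f' assume "(f has_derivative f') (at x)"
  then have "((\<lambda>s. f (fst x, s)) has_real_derivative f' (0, 1)) (at (snd x))"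
    by (intro has_derivative_imp_DERIV_line) (auto intro!: derivative_eq_intros simp: has_vector_derivative_def)
  then show "pd_T f x = f' (0, 1)" by (simp add: pd_T_def split_beta DERIV_imp_deriv)
qed

lemma DERIV_y_line:
  assumes "(f has_derivative f') (at (y, x))"
  shows "((\<lambda>s. f (s, x)) has_real_derivative f' (1, 0)) (at y)"
  by (rule has_derivative_imp_DERIV_line[where g = "\<lambda>s. (s, x)", OF assms])
    (auto intro!: derivative_eq_intros simp: has_vector_derivative_def)

lemma directional_pd_y: "directional pd_y (1, 0)"
proof (rule directionalI)
  fix f :: "real \<times> slow \<Rightarrow> real" and x f' assume "(f has_derivative f') (at x)"
  then have "((\<lambda>s. f (s, snd x)) has_real_derivative f' (1, 0)) (at (fst x))"
    by (intro DERIV_y_line) simp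
  then show "pd_y f x = f' (1, 0)" by (simp add: pd_y_def split_beta DERIV_imp_deriv)
qed

lemma directional_at_fixed_y:
  assumes "directional d v" shows "directional (at_fixed_y d) (0, v)"
proof (rule directionalI)
  fix f :: "real \<times> slow \<Rightarrow> real" and x f' assume "(f has_derivative f') (at x)"
  then have "((\<lambda>x'. f (fst x, x')) has_derivative (\<lambda>h. f' (0, h))) (at (snd x))"
    by (intro has_derivative_compose[where f = "Pair (fst x)" and g = f and f' = "Pair 0",
          OF has_derivative_Pair[OF has_derivative_const has_derivative_ident]]) simp
  then have "d (\<lambda>x'. f (fst x, x')) (snd x) = f' (0, v)"
    using assms frechet_derivative_at unfolding directional_def differentiable_def
    by (metis (no_types, lifting))
  then show "at_fixed_y d f x = f' (0, v)" by (simp add: at_fixed_y_def split_beta)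
qed

context
  fixes d :: "('a::real_normed_vector \<Rightarrow> real) \<Rightarrow> 'a \<Rightarrow> real" and v :: 'a and S :: "'a set"
  assumes d: "directional d v" and S: "open S"
begin

lemma directional_eqI: "(f has_derivative f') (at x) \<Longrightarrow> d f x = f' v"
  using d frechet_derivative_at by (fastforce simp: directional_def differentiable_def)

lemma directional_eq: "smooth_on S f \<Longrightarrow> x \<in> S \<Longrightarrow> d f x = frechet_derivative f (at x) v"
  by (rule directional_eqI[OF smooth_on_has_derivative])

lemma directional_smooth: "smooth_on S f \<Longrightarrow> smooth_on S (d f)"
  using smooth_on_frechet_derivative[of S f v] smooth_on_cong[OF S, of "d f"] directional_eq by metis

lemma directional_cong:
  assumes "\<And>z. z \<in> S \<Longrightarrow> f z = g z" "smooth_on S g" "x \<in> S"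
  shows "d f x = d g x"
proof -
  have "(f has_derivative frechet_derivative g (at x)) (at x)"
    using has_derivative_transform_within_open[OF smooth_on_has_derivative[OF assms(2,3)] S assms(3)] assms(1)
    by metis
  then show ?thesis using directional_eqI directional_eq[OF assms(2,3)] by simp
qed

lemma directional_const: "d (\<lambda>_. c) x = 0"
  using directional_eqI[OF has_derivative_const] by simp

lemma directional_add:
  "smooth_on S f \<Longrightarrow> smooth_on S g \<Longrightarrow> x \<in> S \<Longrightarrow> d (\<lambda>x. f x + g x) x = d f x + d g x"
  using directional_eqI[OF has_derivative_add[OF smooth_on_has_derivative smooth_on_has_derivative]]
  by (simp add: directional_eq)

lemma directional_mult:
  "smooth_on S f \<Longrightarrow> smooth_on S g \<Longrightarrow> x \<in> S \<Longrightarrow> d (\<lambda>x. f x * g x) x = d f x * g x + f x * d g x"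
  using directional_eqI[OF has_derivative_mult[OF smooth_on_has_derivative smooth_on_has_derivative]]
  by (simp add: directional_eq)

lemma directional_cmult: "smooth_on S f \<Longrightarrow> x \<in> S \<Longrightarrow> d (\<lambda>x. c * f x) x = c * d f x"
  using directional_mult[OF smooth_on_const[OF S, of c]] by (simp add: directional_const)

lemma directional_cdivide: "smooth_on S f \<Longrightarrow> x \<in> S \<Longrightarrow> d (\<lambda>x. f x / c) x = d f x / c"
  using directional_cmult[of f x "inverse c"] by (simp add: divide_inverse mult.commute)

lemma directional_diff:
  "smooth_on S f \<Longrightarrow> smooth_on S g \<Longrightarrow> x \<in> S \<Longrightarrow> d (\<lambda>x. f x - g x) x = d f x - d g x"
  using directional_eqI[OF has_derivative_diff[OF smooth_on_has_derivative smooth_on_has_derivative]]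
  by (simp add: directional_eq)

lemma directional_power:
  "smooth_on S f \<Longrightarrow> x \<in> S \<Longrightarrow> d (\<lambda>x. f x ^ n) x = of_nat n * f x ^ (n - 1) * d f x"
  using directional_eqI[OF has_derivative_power[OF smooth_on_has_derivative]]
  by (simp add: directional_eq)

lemma directional_commute:
  assumes "directional d' w" "smooth_on S f" "x \<in> S"
  shows "d (d' f) x = d' (d f) x"
proof -
  have "d (d' f) x = frechet_derivative (\<lambda>x. frechet_derivative f (at x) w) (at x) v"
    using assms smooth_on_frechet_derivative[OF assms(2)]
    by (subst directional_cong[where g = "\<lambda>x. frechet_derivative f (at x) w"])
      (auto simp: directional_eq directional_def smooth_on_differentiable)
  also have "\<dots> = frechet_derivative (\<lambda>x. frechet_derivative f (at x) v) (at x) w"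
    using frechet_derivative_commute[OF S _ assms(3)] assms(2) unfolding smooth_on_def by blast
  also have "\<dots> = d' (\<lambda>x. frechet_derivative f (at x) v) x"
    using assms(1,3) smooth_on_differentiable[OF smooth_on_frechet_derivative[OF assms(2)]]
    by (simp add: directional_def)
  also have "\<dots> = d' (d f) x"
  proof -
    have *: "(d f has_derivative f') (at x) \<longleftrightarrow> ((\<lambda>x. frechet_derivative f (at x) v) has_derivative f') (at x)" for f'
      using has_derivative_transform_within_open[OF _ S assms(3), of _ f' UNIV] directional_eq[OF assms(2)]
      by (metis (no_types, lifting))
    show ?thesis using assms(1,3) smooth_on_has_derivative[OF smooth_on_frechet_derivative[OF assms(2)]] *
      by (metis (no_types, lifting) directional_def differentiable_def frechet_derivative_at)
  qed
  finally show ?thesis .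
qed

end

section \<open>The cnoidal waves\<close>

text \<open>The oriented integral admits \<open>u\<close> on either side of \<open>c\<close>. The
  compact interval for the fundamental theorem overshoots \<open>c\<close> and \<open>x\<close> by
  1, so that \<open>x\<close> is interior and the derivative is two-sided.\<close>

lemma has_real_derivative_LBINT:
  fixes f :: "real \<Rightarrow> real"
  assumes "continuous_on UNIV f"
  shows "((\<lambda>u. LBINT t=ereal c..ereal u. f t) has_real_derivative f x) (at x)"
proof -
  have "((\<lambda>u. LBINT t=ereal c..ereal u. f t) has_vector_derivative f x)
      (at x within {min c x - 1..max c x + 1})"
    by (rule interval_integral_FTC2) (auto intro: continuous_on_subset[OF assms])
  moreover have "at x within {min c x - 1..max c x + 1} = at x"
    by (rule at_within_interior) auto
  ultimately show ?thesis by (simp add: has_real_derivative_iff_has_vector_derivative)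
qed

section \<open>Elliptic integrals and Jacobi functions of a fixed modulus\<close>

locale elliptic_modulus =
  fixes p :: real
  assumes p: "0 < p" "p < 1"
begin

text \<open>The complementary parameter: \<open>dn^2\<close> takes its values in
  \<open>[q, 1]\<close>.\<close>

definition q where "q = 1 - p\<^sup>2"
definition \<Delta> where "\<Delta> \<theta> = sqrt (1 - p\<^sup>2 * (sin \<theta>)\<^sup>2)"
definition ellE_inc where "ellE_inc \<phi> = (LBINT \<theta>=ereal 0..ereal \<phi>. \<Delta> \<theta>)"

lemma q: "0 < q" "q < 1" using p by (auto simp: q_def power_less_one_iff)

lemma radicand_pos: "1 - p\<^sup>2 * (sin \<theta>)\<^sup>2 > 0"
proof -
  have "p\<^sup>2 * (sin \<theta>)\<^sup>2 \<le> p\<^sup>2 * 1"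
    by (intro mult_left_mono) (auto simp: abs_square_le_1)
  then show ?thesis using q unfolding q_def by linarith
qed

lemma \<Delta>_pos: "\<Delta> \<theta> > 0" using radicand_pos by (simp add: \<Delta>_def)

lemma \<Delta>_sq: "(\<Delta> \<theta>)\<^sup>2 = 1 - p\<^sup>2 * (sin \<theta>)\<^sup>2"
  using radicand_pos[of \<theta>] by (simp add: \<Delta>_def)

lemma DERIV_\<Delta>: "(\<Delta> has_real_derivative - p\<^sup>2 * sin \<theta> * cos \<theta> / \<Delta> \<theta>) (at \<theta>)"
  unfolding \<Delta>_def[abs_def] using radicand_pos[of \<theta>]
  by (auto intro!: derivative_eq_intros simp: divide_simps)

lemma DERIV_ellF: "((\<lambda>\<phi>. ellF \<phi> p) has_real_derivative 1 / \<Delta> \<phi>) (at \<phi>)"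
  unfolding ellF_def \<Delta>_def using radicand_pos
  by (intro has_real_derivative_LBINT continuous_intros) (auto simp: less_imp_neq[symmetric])

lemma DERIV_ellE_inc: "(ellE_inc has_real_derivative \<Delta> \<phi>) (at \<phi>)"
  unfolding ellE_inc_def[abs_def] \<Delta>_def
  by (intro has_real_derivative_LBINT continuous_intros)

lemma ellF_0: "ellF 0 p = 0" by (simp add: ellF_def)

lemma ellE_inc_0: "ellE_inc 0 = 0" by (simp add: ellE_inc_def)

lemma ellE_eq: "ellE p = ellE_inc (pi / 2)" by (simp add: ellE_def ellE_inc_def \<Delta>_def)

lemma \<Delta>_le_1: "\<Delta> \<theta> \<le> 1" by (simp add: \<Delta>_def)

lemma ellF_strict_mono: "a < b \<Longrightarrow> ellF a p < ellF b p"
  by (rule DERIV_pos_imp_increasing[OF _ exI]) (use DERIV_ellF \<Delta>_pos in auto)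

text \<open>The integrand \<open>1 / \<Delta>\<close> is at least 1. Hence \<open>ellF\<close> is
  unbounded in both directions and onto; together with strict monotonicity this makes the
  description in \<open>jacobi_am\<close> well defined.\<close>

lemma ellF_minus_id_mono: "a \<le> b \<Longrightarrow> ellF a p - a \<le> ellF b p - b"
proof (rule DERIV_nonneg_imp_nondecreasing[of a b "\<lambda>x. ellF x p - x"])
  fix x
  have "((\<lambda>x. ellF x p - x) has_real_derivative 1 / \<Delta> x - 1) (at x)"
    by (intro DERIV_diff DERIV_ellF DERIV_ident)
  moreover have "1 / \<Delta> x - 1 \<ge> 0" using \<Delta>_pos[of x] \<Delta>_le_1[of x] by simp
  ultimately show "\<exists>y. ((\<lambda>x. ellF x p - x) has_real_derivative y) (at x) \<and> 0 \<le> y" by blast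
qed

lemma ellF_surj: "\<exists>\<phi>. ellF \<phi> p = x"
proof -
  have "ellF \<bar>x\<bar> p \<ge> x" "ellF (- \<bar>x\<bar>) p \<le> x"
    using ellF_minus_id_mono[of 0 "\<bar>x\<bar>"] ellF_minus_id_mono[of "- \<bar>x\<bar>" 0] ellF_0 by auto
  then show ?thesis
    using IVT[of "\<lambda>\<phi>. ellF \<phi> p" "- \<bar>x\<bar>" x "\<bar>x\<bar>"] DERIV_isCont[OF DERIV_ellF] by auto
qed

lemma jacobi_am_ellF: "jacobi_am (ellF \<phi> p) p = \<phi>"
  unfolding jacobi_am_def
proof (rule the_equality)
  show "\<phi>' = \<phi>" if "ellF \<phi>' p = ellF \<phi> p" for \<phi>'
    using that ellF_strict_mono[of \<phi>' \<phi>] ellF_strict_mono[of \<phi> \<phi>'] by force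
qed simp

lemma ellF_jacobi_am: "ellF (jacobi_am x p) p = x"
  using ellF_surj[of x] jacobi_am_ellF by metis

lemma jacobi_dn_eq: "jacobi_dn x p = \<Delta> (jacobi_am x p)" by (simp add: jacobi_dn_def \<Delta>_def)

lemma DERIV_jacobi_am: "((\<lambda>x. jacobi_am x p) has_real_derivative jacobi_dn x p) (at x)"
proof -
  have "isCont (\<lambda>x. jacobi_am x p) (ellF (jacobi_am x p) p)"
    by (rule isCont_inverse_function[where d = 1])
      (auto simp: jacobi_am_ellF DERIV_isCont[OF DERIV_ellF])
  then have "((\<lambda>x. jacobi_am x p) has_real_derivative inverse (1 / \<Delta> (jacobi_am x p))) (at x)"
    using \<Delta>_pos[of "jacobi_am x p"]
    by (intro DERIV_inverse_function[OF DERIV_ellF, of _ _ "x - 1" "x + 1"])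
      (auto simp: ellF_jacobi_am)
  then show ?thesis by (simp add: jacobi_dn_eq)
qed

lemma ellK_pos: "ellK p > 0"
  using ellF_strict_mono[of 0 "pi / 2"] by (simp add: ellK_def ellF_0)

text \<open>The sine is symmetric about \<open>pi / 2\<close>, so \<open>f (pi - x) + f x\<close> is
  constant; its values at 0 and at \<open>pi / 2\<close> are compared. This passes from the complete
  integrals to a full period of the wave.\<close>

lemma reflection:
  assumes "\<And>x. (f has_real_derivative g (sin x)) (at x)" "f 0 = 0"
  shows "f pi = 2 * f (pi / 2)"
proof -
  have "((\<lambda>x. f (pi - x) + f x) has_real_derivative 0) (at x)" for x
  proof -
    have "((\<lambda>x. f (pi - x)) has_real_derivative g (sin (pi - x)) * (- 1)) (at x)"
      by (rule DERIV_chain2[OF assms(1)]) (auto intro!: derivative_eq_intros)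
    from DERIV_add[OF this assms(1)[of x]] show ?thesis by simp
  qed
  then have "\<forall>x. ((\<lambda>x. f (pi - x) + f x) has_real_derivative 0) (at x)" by blast
  from DERIV_isconst_all[OF this, of 0 "pi / 2"] assms(2) show ?thesis by simp
qed

lemma jacobi_am_period: "jacobi_am (2 * ellK p) p = pi"
proof -
  have "ellF pi p = 2 * ellF (pi / 2) p"
    using DERIV_ellF ellF_0
    by (intro reflection[where g = "\<lambda>s. 1 / sqrt (1 - p\<^sup>2 * s\<^sup>2)"]) (auto simp: \<Delta>_def)
  then show ?thesis using jacobi_am_ellF[of pi] by (simp add: ellK_def)
qed

lemma ellE_inc_pi: "ellE_inc pi = 2 * ellE p"
  using reflection[of ellE_inc "\<lambda>s. sqrt (1 - p\<^sup>2 * s\<^sup>2)"] DERIV_ellE_inc ellE_inc_0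
  by (auto simp: \<Delta>_def ellE_eq)

text \<open>\<open>ellE_inc\<close> composed with the amplitude is a primitive of
  \<open>dn^2\<close>, and as \<open>y\<close> runs over \<open>[0, 1]\<close> the amplitude runs
  from 0 to \<open>pi\<close>.\<close>

lemma mean_dn_sq: "((\<lambda>y. (jacobi_dn (2 * ellK p * y) p)\<^sup>2) has_integral ellE p / ellK p) {0..1}"
proof -
  let ?f = "\<lambda>y. ellE_inc (jacobi_am (2 * ellK p * y) p) / (2 * ellK p)"
  have "(?f has_real_derivative (jacobi_dn (2 * ellK p * y) p)\<^sup>2) (at y)" for y
  proof -
    have "((\<lambda>y. jacobi_am (2 * ellK p * y) p) has_real_derivative jacobi_dn (2 * ellK p * y) p * (2 * ellK p)) (at y)"
      by (rule DERIV_chain2[OF DERIV_jacobi_am]) (auto intro!: derivative_eq_intros)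
    from DERIV_cdivide[OF DERIV_chain2[OF DERIV_ellE_inc this], of "2 * ellK p"]
    show ?thesis using ellK_pos by (simp add: jacobi_dn_eq power2_eq_square)
  qed
  then have "((\<lambda>y. (jacobi_dn (2 * ellK p * y) p)\<^sup>2) has_integral ?f 1 - ?f 0) {0..1}"
    by (intro fundamental_theorem_of_calculus)
      (auto simp: has_real_derivative_iff_has_vector_derivative[symmetric] intro: has_field_derivative_at_within)
  moreover have "jacobi_am 0 p = 0" using jacobi_am_ellF[of 0] by (simp add: ellF_0)
  ultimately show ?thesis
    using ellK_pos by (simp add: jacobi_am_period ellE_inc_pi ellE_inc_0)
qed

text \<open>Since \<open>\<integral> q / \<Delta>\<^sup>3 = \<integral> \<Delta>\<close> over a quarter period, \<open>2 (E - sqrt q K)\<close> is the integral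
  of \<open>(\<Delta>\<^sup>2 - sqrt q)\<^sup>2 / \<Delta>\<^sup>3\<close>.\<close>

lemma ellE_ge: "sqrt q * ellK p \<le> ellE p"
proof -
  \<comment> \<open>The middle term vanishes at both ends and has the derivative
    \<open>\<Delta> - q / \<Delta>^3\<close>; this is the integral identity stated above.\<close>
  let ?g = "\<lambda>\<theta>. 2 * ellE_inc \<theta> - p\<^sup>2 * sin \<theta> * cos \<theta> / \<Delta> \<theta> - 2 * sqrt q * ellF \<theta> p"
  have "?g 0 \<le> ?g (pi / 2)"
  proof (rule DERIV_nonneg_imp_nondecreasing[of 0 "pi / 2" ?g])
    fix x
    let ?D = "\<Delta> x"
    let ?g' = "2 * ?D - (p\<^sup>2 * ((cos x)\<^sup>2 - (sin x)\<^sup>2) * ?D - p\<^sup>2 * sin x * cos x * (- p\<^sup>2 * sin x * cos x / ?D)) / (?D)\<^sup>2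
      - 2 * sqrt q * (1 / ?D)"
    have 1: "((\<lambda>\<theta>. p\<^sup>2 * sin \<theta> * cos \<theta>) has_real_derivative p\<^sup>2 * ((cos x)\<^sup>2 - (sin x)\<^sup>2)) (at x)"
      by (auto intro!: derivative_eq_intros simp: algebra_simps power2_eq_square)
    have "(?g has_real_derivative ?g') (at x)"
      using DERIV_diff[OF DERIV_diff[OF DERIV_cmult[OF DERIV_ellE_inc, of 2] DERIV_divide[OF 1 DERIV_\<Delta>]]
        DERIV_cmult[OF DERIV_ellF, of "2 * sqrt q"]] \<Delta>_pos[of x]
      by (simp add: power2_eq_square)
    moreover have "?g' = ((?D)\<^sup>2 - sqrt q)\<^sup>2 / ?D ^ 3"
    proof -
      have sq: "p\<^sup>2 * (sin x)\<^sup>2 = 1 - (?D)\<^sup>2" "p\<^sup>2 * (cos x)\<^sup>2 = (?D)\<^sup>2 - q"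
        by (simp_all add: \<Delta>_sq q_def cos_squared_eq algebra_simps)
      have "?g' = 2 * ?D - ((p\<^sup>2 * (cos x)\<^sup>2 - p\<^sup>2 * (sin x)\<^sup>2) * (?D)\<^sup>2 + (p\<^sup>2 * (sin x)\<^sup>2) * (p\<^sup>2 * (cos x)\<^sup>2)) / ?D ^ 3
          - 2 * sqrt q / ?D"
        using \<Delta>_pos[of x] by (simp add: field_simps power2_eq_square power3_eq_cube)
      also have "\<dots> = (?D ^ 4 - 2 * sqrt q * (?D)\<^sup>2 + q) / ?D ^ 3"
        unfolding sq using \<Delta>_pos[of x]
        by (simp add: field_simps) (simp add: algebra_simps eval_nat_numeral)
      also have "\<dots> = ((?D)\<^sup>2 - sqrt q)\<^sup>2 / ?D ^ 3"
        using q by (simp add: power2_diff flip: power_mult)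
      finally show ?thesis .
    qed
    ultimately have "(?g has_real_derivative ((?D)\<^sup>2 - sqrt q)\<^sup>2 / ?D ^ 3) (at x)" by (rule DERIV_cong)
    moreover have "((?D)\<^sup>2 - sqrt q)\<^sup>2 / ?D ^ 3 \<ge> 0" using \<Delta>_pos[of x] by simp
    ultimately show "\<exists>y. (?g has_real_derivative y) (at x) \<and> 0 \<le> y" by blast
  qed simp
  then show ?thesis by (simp add: ellE_inc_0 ellF_0 ellE_eq ellK_def)
qed

text \<open>The difference of the two sides is \<alpha> up to a positive factor. Replacing
  \<open>E/K\<close> by its lower bound \<open>sqrt q\<close> leaves a polynomial inequality in
  \<open>r = sqrt q\<close>.\<close>

lemma ellE_ratio_ge: "q * (1 + q) < 2 * (1 - q + q\<^sup>2) * (ellE p / ellK p)"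
proof -
  define r where "r = sqrt q"
  have r: "0 < r" "r < 1" "q = r\<^sup>2" using q by (auto simp: r_def)
  \<comment> \<open>This is the required difference divided by \<open>r\<close>. The double root at
    \<open>r = 1\<close> reflects the limit \<open>p = 0\<close>, where the inequality degenerates
    to an equality.\<close>
  have "0 < (1 - r)\<^sup>2 * (2 * r\<^sup>2 + 3 * r + 2)" using r by (intro mult_pos_pos add_nonneg_pos) auto
  also have "\<dots> = 2 * (1 - q + q\<^sup>2) - r * (1 + q)" by (simp add: r(3)) algebra
  finally have "r * (r * (1 + q)) < r * (2 * (1 - q + q\<^sup>2))" using r by simp
  moreover have "r \<le> ellE p / ellK p" using ellE_ge ellK_pos by (simp add: r_def field_simps)
  then have "r * (2 * (1 - q + q\<^sup>2)) \<le> ellE p / ellK p * (2 * (1 - q + q\<^sup>2))"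
    using q by (intro mult_right_mono) (auto simp: add_nonneg_nonneg)
  moreover have "q * (1 + q) = r * (r * (1 + q))" by (simp add: r(3) power2_eq_square)
  ultimately show ?thesis by (simp only: mult.commute[of "ellE p / ellK p"])
qed

end

section \<open>Mean value and first integral of the wave profile\<close>

lemma has_integral_kdv_U:
  assumes "0 < p" "p < 1"
  shows "((\<lambda>y. kdv_U y k M p) has_integral M) {0..1}"
proof -
  interpret elliptic_modulus p using assms by unfold_locales
  have "((\<lambda>y. M + 8 * (ellK p)\<^sup>2 * k\<^sup>2 * ((jacobi_dn (2 * ellK p * y) p)\<^sup>2 - ellE p / ellK p))
      has_integral M + 8 * (ellK p)\<^sup>2 * k\<^sup>2 * (ellE p / ellK p - ellE p / ellK p)) {0..1}"
    using has_integral_const_real[of M 0 1] has_integral_const_real[of "ellE p / ellK p" 0 1]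
    by (intro has_integral_add has_integral_mult_right has_integral_diff mean_dn_sq) simp_all
  then show ?thesis by (simp add: kdv_U_def kdv_U_tilde_def)
qed

text \<open>Subtracting \<open>c / 6\<close> cancels \<open>E/K\<close> and leaves
  \<open>\<sigma> (dn^2 - (1 + q) / 3)\<close>, so both equations become polynomial identities in
  \<open>dn^2\<close>. The two inequalities are what variation of constants needs later: a nonzero
  Wronskian, and a second solution that is not periodic.\<close>

lemma kdv_wave_ode:
  assumes k: "0 < k" and p: "0 < p" "p < 1"
  obtains A B U' where
    "\<And>y. ((\<lambda>y. kdv_U y k M p) has_real_derivative U' y) (at y)"
    "\<And>y. (U' has_real_derivative (A - 3 * (kdv_U y k M p - kdv_c k M p / 6)\<^sup>2) / k\<^sup>2) (at y)"
    "\<And>y. k\<^sup>2 * (U' y)\<^sup>2 = - 2 * (kdv_U y k M p - kdv_c k M p / 6) ^ 3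
        + 2 * A * (kdv_U y k M p - kdv_c k M p / 6) + B"
    "16 * A ^ 3 - 27 * B\<^sup>2 > 0"
    "9 * B + 12 * A * (M - kdv_c k M p / 6) > 0"
proof -
  interpret elliptic_modulus p using p by unfold_locales
  define K where "K = ellK p"
  define \<sigma> where "\<sigma> = 8 * K\<^sup>2 * k\<^sup>2"
  have K: "K > 0" by (simp add: K_def ellK_pos)
  then have \<sigma>: "\<sigma> > 0" using k by (simp add: \<sigma>_def)
  define e where "e = ellE p / K"
  define am where "am y = jacobi_am (2 * K * y) p" for y
  define d where "d y = \<Delta> (am y)" for y
  define s where "s y = sin (am y)" for y
  define c where "c y = cos (am y)" for y
  have d: "d y > 0" for y by (simp add: d_def \<Delta>_pos)
  have sq: "p\<^sup>2 * (s y)\<^sup>2 = 1 - (d y)\<^sup>2" "p\<^sup>2 * (c y)\<^sup>2 = (d y)\<^sup>2 - q" for y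
    by (simp_all add: d_def s_def c_def \<Delta>_sq q_def cos_squared_eq algebra_simps)
  have Dam: "(am has_real_derivative d y * (2 * K)) (at y)" for y
    unfolding am_def[abs_def] d_def jacobi_dn_eq[symmetric]
    by (rule DERIV_chain2[OF DERIV_jacobi_am]) (auto intro!: derivative_eq_intros)
  have Dd: "(d has_real_derivative - p\<^sup>2 * s y * c y * (2 * K)) (at y)" for y
    using DERIV_chain2[OF DERIV_\<Delta> Dam, of y] d[of y]
    by (simp add: d_def[abs_def] s_def c_def mult.assoc)
  have Ds: "(s has_real_derivative c y * (d y * (2 * K))) (at y)" for y
    unfolding s_def[abs_def] c_def by (rule DERIV_chain2[OF DERIV_sin Dam])
  have Dc: "(c has_real_derivative - s y * (d y * (2 * K))) (at y)" for y
    unfolding s_def c_def[abs_def] by (rule DERIV_chain2[OF DERIV_cos Dam])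
  \<comment> \<open>\<open>A\<close> and \<open>B\<close> come from expanding
    \<open>2 \<sigma>^3 (1 - d^2) (d^2 - q) d^2\<close> in powers of
    \<open>\<sigma> (d^2 - (1 + q) / 3)\<close>. The shift \<open>(1 + q) / 3\<close> is the mean of
    the roots \<open>0\<close>, \<open>q\<close>, \<open>1\<close>, so no quadratic term
    appears.\<close>
  define A where "A = \<sigma>\<^sup>2 * (1 - q + q\<^sup>2) / 3"
  define B where "B = - 2 * \<sigma> ^ 3 * (1 + q) * (2 - q) * (2 * q - 1) / 27"
  define U' where "U' y = - 4 * K * \<sigma> * p\<^sup>2 * (s y * c y * d y)" for y
  have U: "kdv_U y k M p = M + \<sigma> * ((d y)\<^sup>2 - e)" for y
    by (simp add: kdv_U_def kdv_U_tilde_def \<sigma>_def e_def K_def d_def am_def jacobi_dn_eq)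
  have V: "kdv_U y k M p - kdv_c k M p / 6 = \<sigma> * ((d y)\<^sup>2 - (1 + q) / 3)" for y
    unfolding U
    by (simp add: kdv_c_def kdv_c_tilde_def \<sigma>_def e_def K_def[symmetric] q_def)
      (simp add: field_simps)
  show ?thesis
  proof (rule that[of U' A B])
    show "((\<lambda>y. kdv_U y k M p) has_real_derivative U' y) (at y)" for y
      unfolding U U'_def
      by (rule derivative_eq_intros Dd refl)+ (simp add: algebra_simps)
    have "(U' has_real_derivative - 4 * K * \<sigma> * p\<^sup>2 * (2 * K)
        * ((c y)\<^sup>2 * (d y)\<^sup>2 - (s y)\<^sup>2 * (d y)\<^sup>2 - p\<^sup>2 * (s y)\<^sup>2 * (c y)\<^sup>2)) (at y)" for y
      unfolding U'_def[abs_def]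
      by (rule derivative_eq_intros Dd Ds Dc refl)+ (simp add: algebra_simps power2_eq_square)
    moreover have "- 4 * K * \<sigma> * p\<^sup>2 * (2 * K)
        * ((c y)\<^sup>2 * (d y)\<^sup>2 - (s y)\<^sup>2 * (d y)\<^sup>2 - p\<^sup>2 * (s y)\<^sup>2 * (c y)\<^sup>2)
      = (A - 3 * (kdv_U y k M p - kdv_c k M p / 6)\<^sup>2) / k\<^sup>2" for y
    proof -
      have "- 4 * K * \<sigma> * p\<^sup>2 * (2 * K)
        * ((c y)\<^sup>2 * (d y)\<^sup>2 - (s y)\<^sup>2 * (d y)\<^sup>2 - p\<^sup>2 * (s y)\<^sup>2 * (c y)\<^sup>2)
        = - (8 * K\<^sup>2 * \<sigma>) * ((p\<^sup>2 * (c y)\<^sup>2) * (d y)\<^sup>2 - (p\<^sup>2 * (s y)\<^sup>2) * (d y)\<^sup>2 - (p\<^sup>2 * (s y)\<^sup>2) * (p\<^sup>2 * (c y)\<^sup>2))"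
        by (simp add: algebra_simps power2_eq_square)
      also have "\<dots> = - (\<sigma>\<^sup>2 / k\<^sup>2) * (3 * ((d y)\<^sup>2)\<^sup>2 - 2 * (1 + q) * (d y)\<^sup>2 + q)"
        unfolding sq using k by (simp add: \<sigma>_def field_simps power2_eq_square)
      also have "\<dots> = (A - 3 * (kdv_U y k M p - kdv_c k M p / 6)\<^sup>2) / k\<^sup>2"
        unfolding V A_def using k by (simp add: field_simps power2_eq_square)
      finally show ?thesis .
    qed
    ultimately show "(U' has_real_derivative (A - 3 * (kdv_U y k M p - kdv_c k M p / 6)\<^sup>2) / k\<^sup>2) (at y)" for y
      by metis
    show "k\<^sup>2 * (U' y)\<^sup>2 = - 2 * (kdv_U y k M p - kdv_c k M p / 6) ^ 3
        + 2 * A * (kdv_U y k M p - kdv_c k M p / 6) + B" for y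
    proof -
      have "k\<^sup>2 * (U' y)\<^sup>2 = 2 * \<sigma>\<^sup>2 * (8 * K\<^sup>2 * k\<^sup>2) * (p\<^sup>2 * (s y)\<^sup>2) * (p\<^sup>2 * (c y)\<^sup>2) * (d y)\<^sup>2"
        by (simp add: U'_def algebra_simps power2_eq_square)
      also have "\<dots> = 2 * \<sigma> ^ 3 * (1 - (d y)\<^sup>2) * ((d y)\<^sup>2 - q) * (d y)\<^sup>2"
        unfolding sq \<sigma>_def[symmetric] by (simp add: power2_eq_square power3_eq_cube)
      also have "\<dots> = - 2 * (kdv_U y k M p - kdv_c k M p / 6) ^ 3
        + 2 * A * (kdv_U y k M p - kdv_c k M p / 6) + B"
        unfolding V A_def B_def by (simp add: field_simps power2_eq_square power3_eq_cube)
      finally show ?thesis .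
    qed
    \<comment> \<open>Four times the product of the squared differences of the roots of the
      cubic.\<close>
    have "16 * A ^ 3 - 27 * B\<^sup>2 = 4 * \<sigma> ^ 6 * q\<^sup>2 * (1 - q)\<^sup>2"
      unfolding A_def B_def by (simp add: field_simps) algebra
    then show "16 * A ^ 3 - 27 * B\<^sup>2 > 0" using \<sigma> q by simp
    \<comment> \<open>The point 0 is arbitrary: on comparing the two expressions for the profile the
      \<open>d\<close> terms cancel.\<close>
    have M: "M - kdv_c k M p / 6 = \<sigma> * (e - (1 + q) / 3)"
      using V[of 0] unfolding U by (simp add: algebra_simps)
    have "9 * B + 12 * A * (M - kdv_c k M p / 6) = 2 * \<sigma> ^ 3 * (2 * (1 - q + q\<^sup>2) * e - q * (1 + q))"
      unfolding M A_def B_def by (simp add: field_simps) algebra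
    then show "9 * B + 12 * A * (M - kdv_c k M p / 6) > 0"
      using ellE_ratio_ge \<sigma> by (simp add: e_def K_def)
  qed
qed

section \<open>Leading coefficients of the residual\<close>

text \<open>Order zero is the second lowest order of the residual, so two coefficients of every
  factor suffice. The value \<open>a\<close> may vanish, so \<open>m\<close> is only a lower bound
  for the order.\<close>

definition leading :: "'a::zero fls \<Rightarrow> int \<Rightarrow> 'a \<Rightarrow> 'a \<Rightarrow> bool" where
  "leading F m a b \<longleftrightarrow> (\<forall>n<m. fls_nth F n = 0) \<and> fls_nth F m = a \<and> fls_nth F (m + 1) = b"

lemma leading_nth: "leading F m a b \<Longrightarrow> fls_nth F m = a" "leading F m a b \<Longrightarrow> fls_nth F (m + 1) = b"
  by (simp_all add: leading_def)

lemma leading_add: "leading F m a b \<Longrightarrow> leading G m a' b' \<Longrightarrow> leading (F + G) m (a + a') (b + b')"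
  for a :: "'a::monoid_add"
  by (simp add: leading_def)

text \<open>Aligns summands whose natural orders differ by one, such as the slow and the fast part
  of a multiscale derivative.\<close>

lemma leading_weaken: "leading F m a b \<Longrightarrow> leading F (m - 1) 0 a"
  by (simp add: leading_def)

text \<open>The product formula sums from the subdegrees, which are unknown when leading values may
  vanish; any lower bounds do as well. The zero series is treated apart because its subdegree is 0
  by convention and may lie below the bound.\<close>

lemma fls_times_nth_from:
  fixes F G :: "'a::semiring_0 fls"
  assumes "\<And>n. n < m \<Longrightarrow> fls_nth F n = 0" "\<And>n. n < k \<Longrightarrow> fls_nth G n = 0"
  shows "fls_nth (F * G) n = (\<Sum>i=m..n - k. fls_nth F i * fls_nth G (n - i))"
proof (cases "F = 0 \<or> G = 0")
  case False
  then have "m \<le> fls_subdegree F" "k \<le> fls_subdegree G"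
    using assms by (metis fls_subdegree_geI)+
  then show ?thesis
    unfolding fls_times_nth(2) by (intro sum.mono_neutral_left) auto
qed auto

lemma leading_mult:
  fixes F G :: "'a::semiring_0 fls"
  assumes "leading F m a b" "leading G k a' b'"
  shows "leading (F * G) (m + k) (a * a') (a * b' + b * a')"
proof -
  have *: "fls_nth (F * G) n = (\<Sum>i=m..n - k. fls_nth F i * fls_nth G (n - i))" for n
    using assms by (intro fls_times_nth_from) (auto simp: leading_def)
  have "{m..m + 1} = {m, m + 1}" by auto
  then show ?thesis
    using assms unfolding leading_def by (simp add: * algebra_simps)
qed

text \<open>The lower bound \<open>m\<close>, common to all points, together with
  \<open>d 0 = 0\<close> ensures that \<open>Abs_fls\<close> returns the intended
  coefficients.\<close>

lemma leading_coeffwise: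
  assumes "\<And>z. leading (F z) m (a z) (b z)" "\<And>z. d (\<lambda>_. 0) z = 0"
  shows "leading (coeffwise d F z) m (d a z) (d b z)"
proof -
  have "fls_nth (coeffwise d F z) n = d (\<lambda>w. fls_nth (F w) n) z" for n
    unfolding coeffwise_def using assms
    by (intro nth_Abs_fls_ex_lower_bound exI[of _ m]) (auto simp: leading_def)
  then show ?thesis using assms by (simp add: leading_def)
qed

lemma leading_eps_series: "leading (eps_series a z) 0 (a 0 z) (a 1 z)"
  by (simp add: leading_def eps_series_def)

lemma leading_multiscale:
  assumes "\<And>z. leading (F z) m (a z) (b z)" "\<And>x. d (\<lambda>_. 0) x = 0"
  shows "leading (multiscale d \<phi> F z) (m - 1) (d (\<phi> 0) (snd z) * pd_y a z)
    (at_fixed_y d a z + d (\<phi> 0) (snd z) * pd_y b z + d (\<phi> 1) (snd z) * pd_y a z)"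
proof -
  obtain y x where z: "z = (y, x)" by (cases z)
  have "leading (coeffwise (at_fixed_y d) F z) m (at_fixed_y d a z) (at_fixed_y d b z)"
    using assms by (intro leading_coeffwise) (auto simp: at_fixed_y_def)
  from leading_weaken[OF this]
  have 1: "leading (coeffwise (at_fixed_y d) F z) (m - 1) 0 (at_fixed_y d a z)" .
  have "leading (fls_X_inv :: real fls) (- 1) 1 0" by (simp add: leading_def)
  note leading_mult[OF leading_mult[OF this leading_eps_series[of "\<lambda>j. d (\<phi> j)" x]]
      leading_coeffwise[where F = F and d = pd_y, OF assms(1)]]
  then have "leading (fls_X_inv * eps_series (\<lambda>j. d (\<phi> j)) x * coeffwise pd_y F z) (m - 1)
      (d (\<phi> 0) x * pd_y a z) (d (\<phi> 0) x * pd_y b z + d (\<phi> 1) x * pd_y a z)"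
    by (simp add: pd_y_def split_beta)
  from leading_add[OF 1 this] show ?thesis
    unfolding multiscale_def z by (simp add: add.assoc)
qed

text \<open>\<open>a1\<close>, ..., \<open>a4\<close> and \<open>b1\<close>, \<open>b2\<close>,
  \<open>b3\<close> are the lowest and next coefficients of the iterated multiscale
  \<open>X\<close>-derivatives, the \<open>n\<close>-th of which starts at order \<open>- n\<close>.
  The weights \<open>\<epsilon>^2\<close> and \<open>\<epsilon>^4\<close> put the dispersive term at
  order -1 and the two dissipative terms at order 0, so the latter enter through \<open>a2\<close>
  and \<open>a4\<close> alone.\<close>

lemma leading_residual:
  fixes \<phi> u
  defines "\<kappa> \<equiv> \<lambda>z. pd_X (\<phi> 0) (snd z)" and "\<kappa>1 \<equiv> \<lambda>z. pd_X (\<phi> 1) (snd z)"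
  defines "a1 \<equiv> \<lambda>z. \<kappa> z * pd_y (u 0) z"
  defines "b1 \<equiv> \<lambda>z. at_fixed_y pd_X (u 0) z + \<kappa> z * pd_y (u 1) z + \<kappa>1 z * pd_y (u 0) z"
  defines "a2 \<equiv> \<lambda>z. \<kappa> z * pd_y a1 z"
  defines "b2 \<equiv> \<lambda>z. at_fixed_y pd_X a1 z + \<kappa> z * pd_y b1 z + \<kappa>1 z * pd_y a1 z"
  defines "a3 \<equiv> \<lambda>z. \<kappa> z * pd_y a2 z"
  defines "b3 \<equiv> \<lambda>z. at_fixed_y pd_X a2 z + \<kappa> z * pd_y b2 z + \<kappa>1 z * pd_y a2 z"
  defines "a4 \<equiv> \<lambda>z. \<kappa> z * pd_y a3 z"
  shows "leading (residual \<delta> \<phi> u z) (- 1)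
    (pd_T (\<phi> 0) (snd z) * pd_y (u 0) z + 6 * u 0 z * a1 z + a3 z)
    (at_fixed_y pd_T (u 0) z + pd_T (\<phi> 0) (snd z) * pd_y (u 1) z + pd_T (\<phi> 1) (snd z) * pd_y (u 0) z
     + 6 * (u 0 z * b1 z + u 1 z * a1 z) + b3 z + \<delta> * (a2 z + a4 z))"
proof -
  have 0: "pd_X (\<lambda>_. 0) x = 0" "pd_T (\<lambda>_. 0) x = 0" for x
    by (simp_all add: pd_X_def pd_T_def split_beta)
  let ?DX = "multiscale pd_X \<phi>"
  let ?v = "eps_series u"
  note v = leading_eps_series[of u]
  have X1: "leading (?DX ?v z) (- 1) (a1 z) (b1 z)" for z
    using leading_multiscale[where d = pd_X and F = ?v and \<phi> = \<phi>, OF v 0(1)]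
    by (simp add: a1_def b1_def \<kappa>_def \<kappa>1_def)
  have X2: "leading ((?DX ^^ 2) ?v z) (- 2) (a2 z) (b2 z)" for z
    using leading_multiscale[where d = pd_X and F = "?DX ?v" and \<phi> = \<phi>, OF X1 0(1)]
    by (simp add: a2_def b2_def \<kappa>_def \<kappa>1_def numeral_2_eq_2)
  have X3: "leading ((?DX ^^ 3) ?v z) (- 3) (a3 z) (b3 z)" for z
    using leading_multiscale[where d = pd_X and F = "(?DX ^^ 2) ?v" and \<phi> = \<phi>, OF X2 0(1)]
    by (simp add: a3_def b3_def \<kappa>_def \<kappa>1_def numeral_3_eq_3 numeral_2_eq_2)
  have X4: "leading ((?DX ^^ 4) ?v z) (- 4) (a4 z)
      (at_fixed_y pd_X a3 z + \<kappa> z * pd_y b3 z + \<kappa>1 z * pd_y a3 z)" for z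
    using leading_multiscale[where d = pd_X and F = "(?DX ^^ 3) ?v" and \<phi> = \<phi>, OF X3 0(1)]
    by (simp add: a4_def \<kappa>_def \<kappa>1_def numeral_3_eq_3 eval_nat_numeral)
  have T1: "leading (multiscale pd_T \<phi> ?v z) (- 1) (pd_T (\<phi> 0) (snd z) * pd_y (u 0) z)
     (at_fixed_y pd_T (u 0) z + pd_T (\<phi> 0) (snd z) * pd_y (u 1) z + pd_T (\<phi> 1) (snd z) * pd_y (u 0) z)"
    using leading_multiscale[where d = pd_T and F = ?v and \<phi> = \<phi>, OF v 0(2)] by simp
  have X: "leading (fls_X ^ n :: real fls) (int n) 1 0" for n
    by (simp add: leading_def fls_X_power_nth)
  have 6: "leading (6 :: real fls) 0 6 0"
    by (simp add: leading_def)
  have c: "leading (fls_const \<delta>) 0 \<delta> 0" by (simp add: leading_def)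
  have N: "leading (6 * ?v z * ?DX ?v z) (- 1) (6 * u 0 z * a1 z) (6 * (u 0 z * b1 z + u 1 z * a1 z))"
    using leading_mult[OF leading_mult[OF 6 v] X1] by (simp add: algebra_simps)
  have D3: "leading (fls_X ^ 2 * (?DX ^^ 3) ?v z) (- 1) (a3 z) (b3 z)"
    using leading_mult[OF X[of 2] X3] by simp
  have D2: "leading (fls_X ^ 2 * (?DX ^^ 2) ?v z) (- 1) 0 (a2 z)"
    using leading_weaken[OF leading_mult[OF X[of 2] X2]] by simp
  have D4: "leading (fls_X ^ 4 * (?DX ^^ 4) ?v z) (- 1) 0 (a4 z)"
    using leading_weaken[OF leading_mult[OF X[of 4] X4]] by simp
  have "leading (fls_const \<delta> * (fls_X ^ 2 * (?DX ^^ 2) ?v z + fls_X ^ 4 * (?DX ^^ 4) ?v z)) (- 1) 0 (\<delta> * (a2 z + a4 z))"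
    using leading_mult[OF c leading_add[OF D2 D4]] by simp
  from leading_add[OF leading_add[OF leading_add[OF T1 N] D3] this]
  show ?thesis unfolding residual_def Let_def by simp
qed

section \<open>Functions of the fast and the slow variables\<close>

locale slow_domain =
  fixes D :: "slow set"
  assumes open_D: "open D"
begin

abbreviation "\<D> \<equiv> (UNIV :: real set) \<times> D"
abbreviation "dX \<equiv> at_fixed_y pd_X"
abbreviation "dT \<equiv> at_fixed_y pd_T"
abbreviation "profile \<equiv> smooth_profile D"

lemma open_\<D>: "open \<D>" by (simp add: open_D open_Times)

lemmas directional_X = directional_at_fixed_y[OF directional_pd_X]
lemmas directional_T = directional_at_fixed_y[OF directional_pd_T]

lemma smooth_lift: "smooth_on D g \<Longrightarrow> smooth_on \<D> (\<lambda>z. g (snd z))"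
proof (rule smooth_on_compose[OF open_\<D> open_D])
  show "smooth_on \<D> (\<lambda>z. snd z \<bullet> b)" for b
    by (intro smooth_on_bounded_linear open_\<D> bounded_linear_compose[OF bounded_linear_inner_left bounded_linear_snd])
qed auto

lemma smooth_slice: "smooth_on \<D> f \<Longrightarrow> smooth_on D (\<lambda>x. f (y, x))"
proof (rule smooth_on_compose[OF open_D open_\<D>])
  have "smooth_on D (\<lambda>x. y * fst b + x \<bullet> snd b)" for b
    by (intro smooth_on_add smooth_on_const open_D smooth_on_bounded_linear bounded_linear_inner_left)
  then show "smooth_on D (\<lambda>x. (y, x) \<bullet> b)" for b by (simp add: inner_prod_def)
qed auto

lemma smooth_fst: "smooth_on \<D> fst"
  by (intro smooth_on_bounded_linear open_\<D> bounded_linear_fst)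

lemmas smooth_simps =
  smooth_on_const[OF open_\<D>] smooth_on_add[OF open_\<D>] smooth_on_mult[OF open_\<D>]
  smooth_on_diff[OF open_\<D>] smooth_on_minus[OF open_\<D>] smooth_on_power[OF open_\<D>]
  smooth_on_divide[OF open_\<D>] smooth_lift smooth_fst
  directional_smooth[OF directional_pd_y open_\<D>]
  directional_smooth[OF directional_X open_\<D>] directional_smooth[OF directional_T open_\<D>]
  smooth_on_const[OF open_D] smooth_on_add[OF open_D] smooth_on_mult[OF open_D]
  smooth_on_diff[OF open_D] smooth_on_minus[OF open_D] smooth_on_power[OF open_D]
  smooth_on_divide[OF open_D] smooth_slice
  directional_smooth[OF directional_pd_X open_D] directional_smooth[OF directional_pd_T open_D]

lemma pd_y_lift: "pd_y (\<lambda>z. g (snd z)) z = 0"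
  by (simp add: pd_y_def split_beta)

lemma pd_y_fst: "pd_y fst z = 1"
  by (simp add: pd_y_def split_beta)

lemma at_fixed_y_lift: "at_fixed_y d (\<lambda>z. g (snd z)) z = d g (snd z)"
  by (simp add: at_fixed_y_def split_beta)

lemmas pd_y_simps =
  directional_const[OF directional_pd_y open_\<D>] pd_y_lift pd_y_fst
  directional_add[OF directional_pd_y open_\<D>] directional_diff[OF directional_pd_y open_\<D>]
  directional_mult[OF directional_pd_y open_\<D>] directional_power[OF directional_pd_y open_\<D>]
  directional_cdivide[OF directional_pd_y open_\<D>]

lemmas pd_X_simps =
  directional_const[OF directional_X open_\<D>] at_fixed_y_lift[where d = pd_X]
  directional_add[OF directional_X open_\<D>] directional_diff[OF directional_X open_\<D>]
  directional_mult[OF directional_X open_\<D>] directional_power[OF directional_X open_\<D>]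
  directional_cdivide[OF directional_X open_\<D>]

lemmas pd_T_simps =
  directional_const[OF directional_T open_\<D>] at_fixed_y_lift[where d = pd_T]
  directional_add[OF directional_T open_\<D>] directional_diff[OF directional_T open_\<D>]
  directional_mult[OF directional_T open_\<D>] directional_power[OF directional_T open_\<D>]
  directional_cdivide[OF directional_T open_\<D>]

lemmas pd_y_cong = directional_cong[OF directional_pd_y open_\<D>]
lemmas dX_cong = directional_cong[OF directional_X open_\<D>]
lemmas pd_y_dX = directional_commute[OF directional_pd_y open_\<D> directional_X]

lemma DERIV_pd_y:
  assumes "smooth_on \<D> f" "x \<in> D"
  shows "((\<lambda>s. f (s, x)) has_real_derivative pd_y f (y, x)) (at y)"
  using DERIV_y_line[OF smooth_on_has_derivative[OF assms(1)]] assms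
    directional_eq[OF directional_pd_y open_\<D> assms(1), of "(y, x)"] by simp

lemma pd_y_translate: "pd_y (\<lambda>z. f (fst z + c, snd z)) (y, x) = pd_y f (y + c, x)"
proof -
  have "((\<lambda>s. f (s + c, x)) has_real_derivative a) (at y) \<longleftrightarrow> ((\<lambda>s. f (s, x)) has_real_derivative a) (at (y + c))" for a
    using DERIV_shift[of "\<lambda>s. f (s, x)" a y c] by simp
  then show ?thesis by (simp add: pd_y_def deriv_def)
qed

lemma profile_smooth: "profile f \<Longrightarrow> smooth_on \<D> f" by (simp add: smooth_profile_def)

lemma profile_periodic: "profile f \<Longrightarrow> x \<in> D \<Longrightarrow> f (y + 1, x) = f (y, x)"
  by (simp add: smooth_profile_def)

lemma profile_pd_y:
  assumes "profile f" shows "profile (pd_y f)"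
proof -
  have "pd_y f (y + 1, x) = pd_y f (y, x)" if "x \<in> D" for x y
    unfolding pd_y_translate[symmetric]
    by (rule pd_y_cong) (use assms that in \<open>auto simp: smooth_profile_def\<close>)
  then show ?thesis using assms by (simp add: smooth_profile_def smooth_simps)
qed

lemma profile_at_fixed_y:
  assumes "profile f" and d: "directional d v"
  shows "profile (at_fixed_y d f)"
proof -
  have "at_fixed_y d f (y + 1, x) = at_fixed_y d f (y, x)" if "x \<in> D" for x y
    unfolding at_fixed_y_def prod.case
    by (rule directional_cong[OF d open_D]) (use assms that in \<open>auto simp: smooth_profile_def smooth_slice\<close>)
  then show ?thesis
    using assms directional_smooth[OF directional_at_fixed_y[OF d] open_\<D>] by (simp add: smooth_profile_def)
qed

lemma profile_const: "profile (\<lambda>_. c)"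
  and profile_lift: "smooth_on D g \<Longrightarrow> profile (\<lambda>z. g (snd z))"
  and profile_add: "profile f \<Longrightarrow> profile h \<Longrightarrow> profile (\<lambda>z. f z + h z)"
  and profile_diff: "profile f \<Longrightarrow> profile h \<Longrightarrow> profile (\<lambda>z. f z - h z)"
  and profile_minus: "profile f \<Longrightarrow> profile (\<lambda>z. - f z)"
  and profile_mult: "profile f \<Longrightarrow> profile h \<Longrightarrow> profile (\<lambda>z. f z * h z)"
  and profile_cdivide: "profile f \<Longrightarrow> profile (\<lambda>z. f z / a)"
  and profile_power: "profile f \<Longrightarrow> profile (\<lambda>z. f z ^ n)"
  by (simp_all add: smooth_profile_def smooth_simps divide_inverse)

lemmas profile_simps = profile_cdivide profile_const profile_lift profile_add profile_diff profile_minus profile_mult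
  profile_power profile_pd_y profile_at_fixed_y[OF _ directional_pd_X] profile_at_fixed_y[OF _ directional_pd_T]

lemma integrable_slice:
  assumes "smooth_on \<D> f" "x \<in> D" shows "(\<lambda>y. f (y, x)) integrable_on {a..b}"
  using DERIV_pd_y[OF assms] by (intro integrable_continuous_real DERIV_continuous_on) (auto intro: has_field_derivative_at_within)

lemma has_integral_pd_y:
  assumes "smooth_on \<D> f" "x \<in> D" shows "((\<lambda>y. pd_y f (y, x)) has_integral f (1, x) - f (0, x)) {0..1}"
  using DERIV_pd_y[OF assms]
  by (intro fundamental_theorem_of_calculus)
    (auto simp: has_real_derivative_iff_has_vector_derivative[symmetric] intro: has_field_derivative_at_within)

lemma mean_pd_y:
  assumes "profile f" "x \<in> D" shows "mean (\<lambda>y. pd_y f (y, x)) = 0"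
  using has_integral_pd_y[OF profile_smooth[OF assms(1)] assms(2)] profile_periodic[OF assms, of 0]
  by (auto simp: mean_def)

lemma mean_add:
  "smooth_on \<D> f \<Longrightarrow> smooth_on \<D> g \<Longrightarrow> x \<in> D \<Longrightarrow>
    mean (\<lambda>y. f (y, x) + g (y, x)) = mean (\<lambda>y. f (y, x)) + mean (\<lambda>y. g (y, x))"
  unfolding mean_def by (intro integral_add integrable_slice)

lemma mean_cmult: "mean (\<lambda>y. c * f y) = c * mean f"
  unfolding mean_def by simp

lemma directional_mean:
  assumes d: "directional d v" and f: "smooth_on \<D> f" and x: "x \<in> D"
  shows "d (\<lambda>x. mean (\<lambda>y. f (y, x))) x = mean (\<lambda>y. at_fixed_y d f (y, x))"
proof -
  have "Ck_on (Suc 0) \<D> f" using f by (simp only: smooth_on_def)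
  from directional_eqI[OF d open_D has_derivative_parametric_integral[OF open_D this x]]
  show ?thesis
    using directional_eq[OF directional_at_fixed_y[OF d] open_\<D> f] x
    by (simp add: mean_def cong: integral_cong)
qed

lemma smooth_mean: "smooth_on \<D> f \<Longrightarrow> smooth_on D (\<lambda>x. mean (\<lambda>y. f (y, x)))"
  unfolding mean_def by (rule smooth_on_parametric_integral[OF open_D])

subsection \<open>The primitive in the fast variable\<close>

text \<open>Scaling the interval of integration to \<open>[0, 1]\<close> makes smoothness in all variables an
  instance of smoothness of a parametric integral.\<close>

definition primitive :: "(real \<times> slow \<Rightarrow> real) \<Rightarrow> real \<times> slow \<Rightarrow> real" where
  "primitive f z = fst z * integral {0..1} (\<lambda>s. f (s * fst z, snd z))"

lemma primitive_0: "primitive f (0, x) = 0"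
  and primitive_1: "primitive f (1, x) = mean (\<lambda>y. f (y, x))"
  by (simp_all add: primitive_def mean_def)

lemma smooth_primitive:
  assumes "smooth_on \<D> f" shows "smooth_on \<D> (primitive f)"
proof -
  have O: "open (UNIV \<times> \<D> :: (real \<times> real \<times> slow) set)" by (intro open_Times open_UNIV open_D)
  have lin: "smooth_on (UNIV \<times> \<D>) h" if "bounded_linear h" for h :: "real \<times> real \<times> slow \<Rightarrow> real"
    by (rule smooth_on_bounded_linear[OF O that])
  have "smooth_on (UNIV \<times> \<D>) (\<lambda>w :: real \<times> real \<times> slow. f (fst w * fst (snd w), snd (snd w)))"
  proof (rule smooth_on_compose[OF O open_\<D> assms])
    fix b :: "real \<times> slow"
    have "smooth_on (UNIV \<times> \<D>) (\<lambda>w :: real \<times> real \<times> slow. fst w * fst (snd w) * fst b + snd (snd w) \<bullet> snd b)"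
      by (intro smooth_on_add smooth_on_mult smooth_on_const O lin bounded_linear_fst
          bounded_linear_compose[OF bounded_linear_fst bounded_linear_snd]
          bounded_linear_compose[OF bounded_linear_inner_left
            bounded_linear_compose[OF bounded_linear_snd bounded_linear_snd]])
    then show "smooth_on (UNIV \<times> \<D>) (\<lambda>w :: real \<times> real \<times> slow. (fst w * fst (snd w), snd (snd w)) \<bullet> b)"
      by (simp add: inner_prod_def)
  qed auto
  from smooth_on_parametric_integral[OF open_\<D> this]
  have "smooth_on \<D> (\<lambda>z. fst z * integral {0..1} (\<lambda>s. f (s * fst z, snd z)))"
    by (simp add: smooth_simps)
  then show ?thesis unfolding primitive_def[abs_def] .
qed

text \<open>The substitution \<open>t = s y\<close> identifies the scaled integral with the ordinary
  oriented primitive, for \<open>y\<close> of either sign.\<close>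

lemma pd_y_primitive:
  assumes f: "smooth_on \<D> f" and x: "x \<in> D"
  shows "pd_y (primitive f) (y, x) = f (y, x)"
proof -
  define F where "F u = (LBINT t=ereal 0..ereal u. f (t, x))" for u
  have F: "(F has_real_derivative f (y, x)) (at y)" for y
    unfolding F_def[abs_def]
    by (rule has_real_derivative_LBINT)
      (use DERIV_pd_y[OF f x] in \<open>auto intro!: DERIV_continuous_on\<close>)
  have "primitive f (y, x) = F y" for y
  proof -
    have "((\<lambda>s. F (s * y)) has_real_derivative f (s * y, x) * y) (at s)" for s
      by (rule DERIV_chain2[OF F]) (auto intro!: derivative_eq_intros)
    then have "((\<lambda>s. f (s * y, x) * y) has_integral F (1 * y) - F (0 * y)) {0..1}"
      by (intro fundamental_theorem_of_calculus)
        (auto simp: has_real_derivative_iff_has_vector_derivative[symmetric] intro: has_field_derivative_at_within)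
    from integral_unique[OF this] have "integral {0..1} (\<lambda>s. f (s * y, x)) * y = F y"
      by (simp add: F_def)
    then show ?thesis by (simp add: primitive_def mult.commute)
  qed
  with F[of y] show ?thesis by (simp add: pd_y_def DERIV_imp_deriv)
qed

lemma eq_of_pd_y_eq:
  assumes "smooth_on \<D> f" "smooth_on \<D> g" "x \<in> D"
    and "\<And>y. pd_y f (y, x) = pd_y g (y, x)" "f (0, x) = g (0, x)"
  shows "f (y, x) = g (y, x)"
proof -
  have "((\<lambda>s. f (s, x) - g (s, x)) has_real_derivative 0) (at y)" for y
    using DERIV_diff[OF DERIV_pd_y[OF assms(1,3)] DERIV_pd_y[OF assms(2,3)]] assms(4) by simp
  then have "\<forall>y. ((\<lambda>s. f (s, x) - g (s, x)) has_real_derivative 0) (at y)" by blast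
  from DERIV_isconst_all[OF this, of y 0] assms(5) show ?thesis by simp
qed

lemma smooth_translate:
  assumes "smooth_on \<D> f" shows "smooth_on \<D> (\<lambda>z. f (fst z + c, snd z))"
proof (rule smooth_on_compose[OF open_\<D> open_\<D> assms])
  fix b :: "real \<times> slow"
  have "smooth_on \<D> (\<lambda>z. z \<bullet> b + c * fst b)"
    by (intro smooth_on_add smooth_on_const open_\<D> smooth_on_bounded_linear bounded_linear_inner_left)
  then show "smooth_on \<D> (\<lambda>z. (fst z + c, snd z) \<bullet> b)" by (simp add: inner_prod_def algebra_simps)
qed auto

text \<open>Both sides have the same \<open>y\<close>-derivative and agree at \<open>y = 0\<close>.
  The term with \<open>a\<close> is meant for the product of \<open>h\<close> with the second
  solution, which is periodic only up to a multiple of \<open>V'\<close>; \<open>a = 0\<close> is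
  the periodic case.\<close>

lemma primitive_translate:
  assumes f: "smooth_on \<D> f" and g: "smooth_on \<D> g" and x: "x \<in> D"
    and "\<And>y. f (y + 1, x) = f (y, x) + a * g (y, x)"
  shows "primitive f (y + 1, x) = primitive f (y, x) + a * primitive g (y, x) + primitive f (1, x)"
proof -
  have "(\<lambda>z. primitive f (fst z + 1, snd z)) (y, x)
      = (\<lambda>z. primitive f z + a * primitive g z + primitive f (1, x)) (y, x)"
    by (rule eq_of_pd_y_eq)
      (use assms in \<open>simp_all add: smooth_simps smooth_primitive smooth_translate pd_y_translate
          pd_y_simps pd_y_primitive primitive_0\<close>)
  then show ?thesis by simp
qed

lemma profile_primitive:
  assumes "profile f" "\<And>x. x \<in> D \<Longrightarrow> mean (\<lambda>y. f (y, x)) = 0"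
  shows "profile (primitive f)"
  using assms primitive_translate[where f = f and g = f and a = 0]
  by (auto simp: smooth_profile_def smooth_primitive primitive_1)

end

section \<open>The equation at order \<open>\<epsilon>\<^sup>0\<close>\<close>

locale modulated_ansatz = slow_domain D for D +
  fixes \<delta> :: real and \<phi> u k0 M0 p0
  assumes ansatz: "formal_ansatz D \<phi> u"
    and wave: "modulated_wave D (\<phi> 0) (u 0) k0 M0 p0"
begin

abbreviation "U \<equiv> u 0"
abbreviation "k \<equiv> pd_X (\<phi> 0)"
abbreviation "\<omega> \<equiv> pd_T (\<phi> 0)"
abbreviation "k1 \<equiv> pd_X (\<phi> 1)"
abbreviation "\<omega>1 \<equiv> pd_T (\<phi> 1)"

text \<open>The part of the order-zero coefficient that contains the corrector. Since
  \<open>\<omega> = - k c\<close>, it is \<open>k ((6 U - c) v)' + k^3 v'''\<close>, the linearised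
  travelling-wave operator.\<close>

definition lin :: "(real \<times> slow \<Rightarrow> real) \<Rightarrow> real \<times> slow \<Rightarrow> real" where
  "lin v z = \<omega> (snd z) * pd_y v z + 6 * k (snd z) * (U z * pd_y v z + v z * pd_y U z)
     + k (snd z) ^ 3 * pd_y (pd_y (pd_y v)) z"

definition rest :: "real \<times> slow \<Rightarrow> real" where
  "rest z = dT U z + \<omega>1 (snd z) * pd_y U z + 6 * U z * (dX U z + k1 (snd z) * pd_y U z)
     + 3 * k (snd z) * pd_X k (snd z) * pd_y (pd_y U) z
     + 3 * (k (snd z))\<^sup>2 * dX (pd_y (pd_y U)) z
     + 3 * (k (snd z))\<^sup>2 * k1 (snd z) * pd_y (pd_y (pd_y U)) z
     + \<delta> * ((k (snd z))\<^sup>2 * pd_y (pd_y U) z + k (snd z) ^ 4 * pd_y (pd_y (pd_y (pd_y U))) z)"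

lemma smooth_phi: "smooth_on D (\<phi> j)" and profile_u: "profile (u j)"
  using ansatz by (simp_all add: formal_ansatz_def)

lemma smooth_u: "smooth_on \<D> (u j)"
  using profile_u by (rule profile_smooth)

lemmas sm = smooth_simps smooth_phi smooth_u
lemmas prof = profile_simps profile_u sm

lemma k0_eq: "x \<in> D \<Longrightarrow> k0 x = k x"
  and k_pos: "x \<in> D \<Longrightarrow> k x > 0"
  and p0: "x \<in> D \<Longrightarrow> 0 < p0 x" "x \<in> D \<Longrightarrow> p0 x < 1"
  and \<omega>_eq: "x \<in> D \<Longrightarrow> \<omega> x = - k x * kdv_c (k x) (M0 x) (p0 x)"
  and U_eq: "x \<in> D \<Longrightarrow> U (y, x) = kdv_U y (k x) (M0 x) (p0 x)"
  and smooth_M0: "smooth_on D M0"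
  using wave by (auto simp: modulated_wave_def wave_profile_def)

lemma wave_profile_eq: "x \<in> D \<Longrightarrow> wave_profile k0 M0 p0 (y, x) = U (y, x)"
  using wave by (auto simp: modulated_wave_def)

lemma smooth_k: "smooth_on D k" by (simp add: sm)

section \<open>The wave equation with coefficients smooth in the slow variables\<close>

text \<open>Read off from the phase rather than from \<open>kdv_c\<close>, so that smoothness comes
  from \<open>\<phi> 0\<close> and not from the elliptic integrals.\<close>

definition c where "c x = - \<omega> x / k x"

lemma c_eq: "x \<in> D \<Longrightarrow> c x = kdv_c (k x) (M0 x) (p0 x)"
  using \<omega>_eq k_pos by (simp add: c_def less_imp_neq[symmetric])

lemma smooth_c: "smooth_on D c"
  unfolding c_def[abs_def] using k_pos by (simp add: sm less_imp_neq[symmetric])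

definition V where "V z = U z - c (snd z) / 6"

lemma smooth_V: "smooth_on \<D> V" and profile_V: "profile V"
  and pd_y_V: "x \<in> D \<Longrightarrow> pd_y V (y, x) = pd_y U (y, x)"
proof -
  have *: "V = (\<lambda>z. U z - (\<lambda>x. c x / 6) (snd z))" by (simp add: V_def fun_eq_iff)
  have c6: "smooth_on D (\<lambda>x. c x / 6)" by (simp add: sm smooth_c)
  show "smooth_on \<D> V" "profile V" unfolding * by (intro profile_diff profile_u profile_lift c6 smooth_on_diff open_\<D> smooth_u smooth_lift)+
  show "x \<in> D \<Longrightarrow> pd_y V (y, x) = pd_y U (y, x)"
    unfolding * by (subst directional_diff[OF directional_pd_y open_\<D> smooth_u smooth_lift[OF c6]])
      (simp_all add: pd_y_lift[where g = "\<lambda>x. c x / 6"])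
qed

text \<open>The two integration constants of the profile equation, evaluated at
  \<open>y = 0\<close>: in this form they inherit smoothness from \<open>U\<close>.\<close>

definition A where "A x = (k x)\<^sup>2 * pd_y (pd_y U) (0, x) + 3 * (V (0, x))\<^sup>2"
definition B where "B x = (k x)\<^sup>2 * (pd_y U (0, x))\<^sup>2 + 2 * V (0, x) ^ 3 - 2 * A x * V (0, x)"

lemma smooth_A: "smooth_on D A" and smooth_B: "smooth_on D B"
proof -
  show A: "smooth_on D A" unfolding A_def[abs_def] by (simp add: sm smooth_V)
  show "smooth_on D B" unfolding B_def[abs_def] by (simp add: sm smooth_V A)
qed

lemma mean_U: "x \<in> D \<Longrightarrow> mean (\<lambda>y. U (y, x)) = M0 x"
  using integral_unique[OF has_integral_kdv_U[of "p0 x" "k x" "M0 x"]] p0[of x] by (simp add: mean_def U_eq)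

lemma mean_V: "x \<in> D \<Longrightarrow> mean (\<lambda>y. V (y, x)) = M0 x - c x / 6"
  using mean_add[OF smooth_u[of 0] smooth_lift[of "\<lambda>x. - (c x / 6)"]] mean_U
  by (simp add: V_def mean_def sm smooth_c)

text \<open>The elliptic computation is applied at one fixed \<open>x\<close>; its constants are
  identified with \<open>A x\<close> and \<open>B x\<close> by evaluation at
  \<open>y = 0\<close>.\<close>

lemma
  assumes x: "x \<in> D"
  shows pd_y_y_U: "(k x)\<^sup>2 * pd_y (pd_y U) (y, x) = A x - 3 * (V (y, x))\<^sup>2"
    and pd_y_U_sq: "(k x)\<^sup>2 * (pd_y U (y, x))\<^sup>2 = - 2 * V (y, x) ^ 3 + 2 * A x * V (y, x) + B x"
    and discriminant_pos: "16 * A x ^ 3 - 27 * (B x)\<^sup>2 > 0"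
    and drift_pos: "9 * B x + 12 * A x * (M0 x - c x / 6) > 0"
proof -
  obtain U' A' B' where *:
    "\<And>y. ((\<lambda>y. kdv_U y (k x) (M0 x) (p0 x)) has_real_derivative U' y) (at y)"
    "\<And>y. (U' has_real_derivative (A' - 3 * (kdv_U y (k x) (M0 x) (p0 x) - kdv_c (k x) (M0 x) (p0 x) / 6)\<^sup>2) / (k x)\<^sup>2) (at y)"
    "\<And>y. (k x)\<^sup>2 * (U' y)\<^sup>2 = - 2 * (kdv_U y (k x) (M0 x) (p0 x) - kdv_c (k x) (M0 x) (p0 x) / 6) ^ 3
        + 2 * A' * (kdv_U y (k x) (M0 x) (p0 x) - kdv_c (k x) (M0 x) (p0 x) / 6) + B'"
    "16 * A' ^ 3 - 27 * B'\<^sup>2 > 0"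
    "9 * B' + 12 * A' * (M0 x - kdv_c (k x) (M0 x) (p0 x) / 6) > 0"
    by (rule kdv_wave_ode[OF k_pos[OF x] p0[OF x], of "M0 x"]) (rule that; assumption)
  have V: "V (y, x) = kdv_U y (k x) (M0 x) (p0 x) - kdv_c (k x) (M0 x) (p0 x) / 6" for y
    using x by (simp add: V_def U_eq c_eq)
  have 1: "pd_y U (y, x) = U' y" for y
    using *(1)[of y] x by (simp add: pd_y_def U_eq DERIV_imp_deriv)
  then have "pd_y (pd_y U) (y, x) = (A' - 3 * (V (y, x))\<^sup>2) / (k x)\<^sup>2" for y
    using *(2)[of y] x by (simp add: pd_y_def[of "pd_y U"] V DERIV_imp_deriv)
  then have 2: "(k x)\<^sup>2 * pd_y (pd_y U) (y, x) = A' - 3 * (V (y, x))\<^sup>2" for y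
    using k_pos[OF x] by simp
  have 3: "(k x)\<^sup>2 * (pd_y U (y, x))\<^sup>2 = - 2 * V (y, x) ^ 3 + 2 * A' * V (y, x) + B'" for y
    using *(3)[of y] by (simp add: 1 V)
  have A: "A x = A'" by (simp add: A_def 2)
  moreover have "B x = B'" by (simp add: B_def 3 A)
  ultimately show "(k x)\<^sup>2 * pd_y (pd_y U) (y, x) = A x - 3 * (V (y, x))\<^sup>2"
    "(k x)\<^sup>2 * (pd_y U (y, x))\<^sup>2 = - 2 * V (y, x) ^ 3 + 2 * A x * V (y, x) + B x"
    "16 * A x ^ 3 - 27 * (B x)\<^sup>2 > 0" "9 * B x + 12 * A x * (M0 x - c x / 6) > 0"
    using 2 3 *(4,5) x by (simp_all add: c_eq)
qed

lemma pd_y_y_y_U: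
  assumes x: "x \<in> D"
  shows "(k x)\<^sup>2 * pd_y (pd_y (pd_y U)) (y, x) = - 6 * V (y, x) * pd_y U (y, x)"
proof -
  have "pd_y (\<lambda>z. (k (snd z))\<^sup>2 * pd_y (pd_y U) z) (y, x) = pd_y (\<lambda>z. A (snd z) - 3 * (V z)\<^sup>2) (y, x)"
    by (rule pd_y_cong) (use x in \<open>auto simp: pd_y_y_U sm smooth_V smooth_A\<close>)
  then show ?thesis
    using x by (simp add: pd_y_simps pd_y_lift[where g = A] pd_y_lift[where g = k] sm smooth_A smooth_V pd_y_V)
qed

lemma travelling_wave_equation:
  assumes x: "x \<in> D"
  shows "\<omega> x * pd_y U (y, x) + 6 * k x * (U (y, x) * pd_y U (y, x)) + k x ^ 3 * pd_y (pd_y (pd_y U)) (y, x) = 0"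
proof -
  have "k x ^ 3 * pd_y (pd_y (pd_y U)) (y, x) = k x * ((k x)\<^sup>2 * pd_y (pd_y (pd_y U)) (y, x))"
    by (simp add: power2_eq_square power3_eq_cube)
  also have "\<dots> = - 6 * (k x * V (y, x)) * pd_y U (y, x)"
    unfolding pd_y_y_y_U[OF x] by simp
  also have "k x * V (y, x) = k x * U (y, x) + \<omega> x / 6"
    using k_pos[OF x] by (simp add: V_def c_def field_simps)
  finally show ?thesis by (simp add: algebra_simps)
qed

text \<open>The recursion for the leading coefficients yields nested derivatives of products.
  Smoothness permits expanding them and interchanging \<open>y\<close>- and
  \<open>X\<close>-derivatives, and this collects the factors 3 in \<open>rest\<close>. Order -1 is
  the travelling-wave equation itself.\<close>

lemma
  assumes x: "x \<in> D"
  shows residual_order_minus_1: "fls_nth (residual \<delta> \<phi> u (y, x)) (- 1) = 0"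
    and residual_order_0: "fls_nth (residual \<delta> \<phi> u (y, x)) 0 = rest (y, x) + lin (u 1) (y, x)"
proof -
  define \<kappa> where "\<kappa> z = k (snd z)" for z :: "real \<times> slow"
  define \<kappa>1 where "\<kappa>1 z = k1 (snd z)" for z :: "real \<times> slow"
  define a1 where "a1 = (\<lambda>z. \<kappa> z * pd_y U z)"
  define b1 where "b1 = (\<lambda>z. dX U z + \<kappa> z * pd_y (u 1) z + \<kappa>1 z * pd_y U z)"
  define a2 where "a2 = (\<lambda>z. \<kappa> z * pd_y a1 z)"
  define b2 where "b2 = (\<lambda>z. dX a1 z + \<kappa> z * pd_y b1 z + \<kappa>1 z * pd_y a1 z)"
  define a3 where "a3 = (\<lambda>z. \<kappa> z * pd_y a2 z)"
  define b3 where "b3 = (\<lambda>z. dX a2 z + \<kappa> z * pd_y b2 z + \<kappa>1 z * pd_y a2 z)"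
  define a4 where "a4 = (\<lambda>z. \<kappa> z * pd_y a3 z)"
  have \<kappa>: "smooth_on \<D> \<kappa>" "smooth_on \<D> \<kappa>1" "pd_y \<kappa> z = 0" "pd_y \<kappa>1 z = 0" "dX \<kappa> z = pd_X k (snd z)" for z
    unfolding \<kappa>_def[abs_def] \<kappa>1_def[abs_def]
    by (simp_all only: pd_y_lift at_fixed_y_lift) (simp_all add: sm)
  have \<kappa>': "smooth_on \<D> (dX \<kappa>)" "pd_y (dX \<kappa>) z = 0" for z
  proof -
    have *: "dX \<kappa> = (\<lambda>z. pd_X k (snd z))" using \<kappa>(5) by blast
    show "smooth_on \<D> (dX \<kappa>)" "pd_y (dX \<kappa>) z = 0" unfolding * by (simp_all add: sm pd_y_lift)
  qed
  have a2: "a2 z = (\<kappa> z)\<^sup>2 * pd_y (pd_y U) z" if "z \<in> \<D>" for z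
    unfolding a2_def a1_def using that by (simp add: pd_y_simps sm \<kappa> power2_eq_square)
  have sa2: "smooth_on \<D> a2" unfolding a2_def a1_def by (simp add: sm \<kappa>)
  have a3: "a3 z = \<kappa> z ^ 3 * pd_y (pd_y (pd_y U)) z" if "z \<in> \<D>" for z
  proof -
    have "pd_y a2 z = pd_y (\<lambda>z. (\<kappa> z)\<^sup>2 * pd_y (pd_y U) z) z"
      by (rule pd_y_cong) (use that a2 in \<open>auto simp: sm \<kappa>\<close>)
    then show ?thesis unfolding a3_def using that by (simp add: pd_y_simps sm \<kappa> eval_nat_numeral)
  qed
  have a4: "a4 z = \<kappa> z ^ 4 * pd_y (pd_y (pd_y (pd_y U))) z" if "z \<in> \<D>" for z
  proof -
    have "pd_y a3 z = pd_y (\<lambda>z. \<kappa> z ^ 3 * pd_y (pd_y (pd_y U)) z) z"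
      by (rule pd_y_cong) (use that a3 in \<open>auto simp: sm \<kappa>\<close>)
    then show ?thesis unfolding a4_def using that by (simp add: pd_y_simps sm \<kappa> eval_nat_numeral)
  qed
  have b2: "b2 z = dX \<kappa> z * pd_y U z + 2 * \<kappa> z * dX (pd_y U) z + (\<kappa> z)\<^sup>2 * pd_y (pd_y (u 1)) z
      + 2 * \<kappa> z * \<kappa>1 z * pd_y (pd_y U) z" if "z \<in> \<D>" for z
    unfolding b2_def a1_def b1_def using that
    by (simp add: pd_y_simps pd_X_simps sm \<kappa> \<kappa>' pd_y_dX power2_eq_square) (simp add: algebra_simps)
  have b3: "b3 z = 3 * \<kappa> z * dX \<kappa> z * pd_y (pd_y U) z + 3 * (\<kappa> z)\<^sup>2 * dX (pd_y (pd_y U)) z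
      + \<kappa> z ^ 3 * pd_y (pd_y (pd_y (u 1))) z + 3 * (\<kappa> z)\<^sup>2 * \<kappa>1 z * pd_y (pd_y (pd_y U)) z"
    if "z \<in> \<D>" for z
  proof -
    have 1: "dX a2 z = dX (\<lambda>z. (\<kappa> z)\<^sup>2 * pd_y (pd_y U) z) z"
      by (rule dX_cong) (use that a2 in \<open>auto simp: sm \<kappa>\<close>)
    have 2: "pd_y a2 z = pd_y (\<lambda>z. (\<kappa> z)\<^sup>2 * pd_y (pd_y U) z) z"
      by (rule pd_y_cong) (use that a2 in \<open>auto simp: sm \<kappa>\<close>)
    have 3: "pd_y b2 z = pd_y (\<lambda>z. dX \<kappa> z * pd_y U z + 2 * \<kappa> z * dX (pd_y U) z + (\<kappa> z)\<^sup>2 * pd_y (pd_y (u 1)) z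
      + 2 * \<kappa> z * \<kappa>1 z * pd_y (pd_y U) z) z"
      by (rule pd_y_cong) (use that b2 in \<open>auto simp: sm \<kappa> \<kappa>'\<close>)
    show ?thesis
      unfolding b3_def 1 2 3 using that
      by (simp add: pd_y_simps pd_X_simps sm \<kappa>(1-4) \<kappa>' pd_y_dX)
        (simp add: algebra_simps power2_eq_square power3_eq_cube)
  qed
  note lead = leading_residual[of \<delta> \<phi> u "(y, x)"]
  have z: "(y, x) \<in> \<D>" using x by simp
  have nth: "fls_nth (residual \<delta> \<phi> u (y, x)) (- 1) = \<omega> x * pd_y U (y, x) + 6 * U (y, x) * a1 (y, x) + a3 (y, x)"
    unfolding leading_nth(1)[OF lead] a3_def a2_def a1_def \<kappa>_def by simp
  have nth0: "fls_nth (residual \<delta> \<phi> u (y, x)) 0 = dT U (y, x) + \<omega> x * pd_y (u 1) (y, x) + \<omega>1 x * pd_y U (y, x)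
     + 6 * (U (y, x) * b1 (y, x) + u 1 (y, x) * a1 (y, x)) + b3 (y, x) + \<delta> * (a2 (y, x) + a4 (y, x))"
    using leading_nth(2)[OF lead]
    unfolding b3_def b2_def b1_def a4_def a3_def a2_def a1_def \<kappa>_def \<kappa>1_def by simp
  show "fls_nth (residual \<delta> \<phi> u (y, x)) (- 1) = 0"
    using travelling_wave_equation[OF x, of y]
    unfolding nth a3[OF z] by (simp add: a1_def \<kappa>_def algebra_simps)
  show "fls_nth (residual \<delta> \<phi> u (y, x)) 0 = rest (y, x) + lin (u 1) (y, x)"
    unfolding nth0 a2[OF z] a4[OF z] b3[OF z] rest_def lin_def \<kappa>(5)
    by (simp add: a1_def b1_def \<kappa>_def \<kappa>1_def) (simp add: algebra_simps)
qed

section \<open>Averages of the order-zero equation against 1 and the wave\<close>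

text \<open>The integrand splits into the slow conservation law \<open>f\<close> and the
  \<open>y\<close>-derivative of the periodic \<open>g\<close>; all terms with \<open>v\<close> sit
  in \<open>g\<close>.\<close>

lemma mean_order_0:
  assumes v: "profile v" and x: "x \<in> D"
  shows "mean (\<lambda>y. rest (y, x) + lin v (y, x)) = pd_T M0 x + pd_X (\<lambda>x. mean (\<lambda>y. 3 * (U (y, x))\<^sup>2)) x"
proof -
  note sv = profile_smooth[OF v]
  define f where "f z = dT U z + dX (\<lambda>z. 3 * (U z)\<^sup>2) z" for z
  define g where "g z = \<omega> (snd z) * v z + \<omega>1 (snd z) * U z + 6 * k (snd z) * (U z * v z)
      + 3 * k1 (snd z) * (U z)\<^sup>2 + k (snd z) ^ 3 * pd_y (pd_y v) z
      + 3 * (k (snd z))\<^sup>2 * k1 (snd z) * pd_y (pd_y U) z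
      + 3 * (k (snd z))\<^sup>2 * dX (pd_y U) z + 3 * k (snd z) * pd_X k (snd z) * pd_y U z
      + \<delta> * ((k (snd z))\<^sup>2 * pd_y U z + k (snd z) ^ 4 * pd_y (pd_y (pd_y U)) z)" for z
  have g: "profile g" unfolding g_def[abs_def] by (simp add: prof v)
  have f: "smooth_on \<D> f" unfolding f_def[abs_def] by (simp add: sm)
  have "rest z + lin v z = f z + pd_y g z" if "z \<in> \<D>" for z
    unfolding rest_def lin_def f_def g_def[abs_def] using that
    by (simp add: pd_y_simps pd_X_simps pd_y_lift[where g = k] pd_y_lift[where g = \<omega>]
        pd_y_lift[where g = k1] pd_y_lift[where g = \<omega>1] pd_y_lift[where g = "pd_X k"] sm sv pd_y_dX)
      (simp add: algebra_simps)
  then have "mean (\<lambda>y. rest (y, x) + lin v (y, x)) = mean (\<lambda>y. f (y, x) + pd_y g (y, x))"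
    using x by simp
  also have "\<dots> = mean (\<lambda>y. f (y, x))"
    using mean_add[OF f _ x, of "pd_y g"] mean_pd_y[OF g x] profile_smooth[OF g] by (simp add: sm)
  also have "\<dots> = mean (\<lambda>y. dT U (y, x)) + mean (\<lambda>y. dX (\<lambda>z. 3 * (U z)\<^sup>2) (y, x))"
    unfolding f_def by (rule mean_add[OF _ _ x]) (simp_all add: sm)
  also have "mean (\<lambda>y. dT U (y, x)) = pd_T (\<lambda>x. mean (\<lambda>y. U (y, x))) x"
    using directional_mean[OF directional_pd_T smooth_u x] by simp
  also have "\<dots> = pd_T M0 x"
    by (rule directional_cong[OF directional_pd_T open_D _ smooth_M0 x]) (rule mean_U)
  also have "mean (\<lambda>y. dX (\<lambda>z. 3 * (U z)\<^sup>2) (y, x)) = pd_X (\<lambda>x. mean (\<lambda>y. 3 * (U (y, x))\<^sup>2)) x"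
    using directional_mean[OF directional_pd_X _ x, of "\<lambda>z. 3 * (U z)\<^sup>2"] by (simp add: sm)
  finally show ?thesis .
qed

text \<open>With the multiplier \<open>U\<close>, integration by parts in \<open>y\<close> turns
  \<open>3 k k_X U U'' + 3 k^2 U dX U''\<close> into the \<open>X\<close>-derivative of
  \<open>- 3/2 k^2 U'^2\<close>, and the dissipative terms into
  \<open>- \<delta> k^2 (U'^2 - k^2 U''^2)\<close>, up to \<open>y\<close>-derivatives of periodic
  functions gathered in \<open>g\<close>.\<close>

lemma mean_U_order_0:
  assumes v: "profile v" and x: "x \<in> D"
  shows "mean (\<lambda>y. U (y, x) * (rest (y, x) + lin v (y, x)))
    = 1 / 2 * pd_T (\<lambda>x. mean (\<lambda>y. (U (y, x))\<^sup>2)) x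
      + pd_X (\<lambda>x. mean (\<lambda>y. 2 * U (y, x) ^ 3 - 3 / 2 * (k x)\<^sup>2 * (pd_y U (y, x))\<^sup>2)) x
      - \<delta> * (k x)\<^sup>2 * mean (\<lambda>y. (pd_y U (y, x))\<^sup>2 - (k x)\<^sup>2 * (pd_y (pd_y U) (y, x))\<^sup>2)"
proof -
  note sv = profile_smooth[OF v]
  define f1 where "f1 z = 1 / 2 * dT (\<lambda>z. (U z)\<^sup>2) z" for z
  define f2 where "f2 z = 2 * U z ^ 3 - 3 / 2 * (k (snd z))\<^sup>2 * (pd_y U z)\<^sup>2" for z
  define f3 where "f3 z = (pd_y U z)\<^sup>2 - (k (snd z))\<^sup>2 * (pd_y (pd_y U) z)\<^sup>2" for z
  define g where "g z = U z * (\<omega> (snd z) * v z + 6 * k (snd z) * (U z * v z) + k (snd z) ^ 3 * pd_y (pd_y v) z)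
      - k (snd z) ^ 3 * (pd_y U z * pd_y v z) + k (snd z) ^ 3 * (pd_y (pd_y U) z * v z)
      + 1 / 2 * \<omega>1 (snd z) * (U z)\<^sup>2 + 2 * k1 (snd z) * U z ^ 3
      + 3 * (k (snd z))\<^sup>2 * k1 (snd z) * (U z * pd_y (pd_y U) z - 1 / 2 * (pd_y U z)\<^sup>2)
      + 3 * (k (snd z))\<^sup>2 * (U z * dX (pd_y U) z) + 3 * k (snd z) * pd_X k (snd z) * (U z * pd_y U z)
      + \<delta> * ((k (snd z))\<^sup>2 * (U z * pd_y U z)
          + k (snd z) ^ 4 * (U z * pd_y (pd_y (pd_y U)) z - pd_y U z * pd_y (pd_y U) z))" for z
  have g: "profile g" unfolding g_def[abs_def] by (simp add: prof v)
  have f: "smooth_on \<D> f1" "smooth_on \<D> f2" "smooth_on \<D> f3"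
    unfolding f1_def[abs_def] f2_def[abs_def] f3_def[abs_def] by (simp_all add: sm)
  have "U (y, x) * (rest (y, x) + lin v (y, x))
      = f1 (y, x) + (dX f2 (y, x) + (- \<delta> * (k x)\<^sup>2 * f3 (y, x) + pd_y g (y, x)))" for y
  proof -
    \<comment> \<open>\<open>U\<close> lies in the kernel of the adjoint of \<open>lin\<close>: what
      integration by parts leaves of \<open>U * lin v\<close> is \<open>- v\<close> times the
      travelling-wave equation.\<close>
    have N: "\<omega> x * pd_y U (y, x) * v (y, x) + 6 * k x * (U (y, x) * pd_y U (y, x)) * v (y, x)
        + k x ^ 3 * pd_y (pd_y (pd_y U)) (y, x) * v (y, x) = 0"
      using arg_cong[OF travelling_wave_equation[OF x, of y], of "\<lambda>t. t * v (y, x)"]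
      by (simp add: algebra_simps)
    have *: "U (y, x) * (rest (y, x) + lin v (y, x))
      = f1 (y, x) + (dX f2 (y, x) + (- \<delta> * (k x)\<^sup>2 * f3 (y, x) + pd_y g (y, x)))
       - (\<omega> x * pd_y U (y, x) * v (y, x) + 6 * k x * (U (y, x) * pd_y U (y, x)) * v (y, x)
        + k x ^ 3 * pd_y (pd_y (pd_y U)) (y, x) * v (y, x))"
      unfolding rest_def lin_def f1_def f2_def[abs_def] f3_def g_def[abs_def] using x
      by (simp add: pd_y_simps pd_X_simps pd_T_simps pd_y_lift[where g = k] pd_y_lift[where g = \<omega>]
          pd_y_lift[where g = k1] pd_y_lift[where g = \<omega>1] pd_y_lift[where g = "pd_X k"]
          at_fixed_y_lift[where g = k] sm sv pd_y_dX)
        (simp add: algebra_simps eval_nat_numeral)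
    show ?thesis unfolding * N by simp
  qed
  then have "mean (\<lambda>y. U (y, x) * (rest (y, x) + lin v (y, x)))
      = mean (\<lambda>y. f1 (y, x) + (dX f2 (y, x) + (- \<delta> * (k x)\<^sup>2 * f3 (y, x) + pd_y g (y, x))))"
    by simp
  also have "\<dots> = mean (\<lambda>y. f1 (y, x)) + (mean (\<lambda>y. dX f2 (y, x))
      + (mean (\<lambda>y. - \<delta> * (k x)\<^sup>2 * f3 (y, x)) + mean (\<lambda>y. pd_y g (y, x))))"
    using mean_add[OF f(1) _ x, of "\<lambda>z. dX f2 z + ((- \<delta> * (k x)\<^sup>2) * f3 z + pd_y g z)"]
      mean_add[OF _ _ x, of "dX f2" "\<lambda>z. (- \<delta> * (k x)\<^sup>2) * f3 z + pd_y g z"]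
      mean_add[OF _ _ x, of "\<lambda>z. (- \<delta> * (k x)\<^sup>2) * f3 z" "pd_y g"] f profile_smooth[OF g]
    by (simp add: sm)
  also have "mean (\<lambda>y. f1 (y, x)) = 1 / 2 * pd_T (\<lambda>x. mean (\<lambda>y. (U (y, x))\<^sup>2)) x"
    unfolding f1_def mean_cmult
    using directional_mean[OF directional_pd_T _ x, of "\<lambda>z. (U z)\<^sup>2"] by (simp add: sm)
  also have "mean (\<lambda>y. dX f2 (y, x)) = pd_X (\<lambda>x. mean (\<lambda>y. f2 (y, x))) x"
    using directional_mean[OF directional_pd_X f(2) x] by simp
  also have "mean (\<lambda>y. - \<delta> * (k x)\<^sup>2 * f3 (y, x)) = - \<delta> * (k x)\<^sup>2 * mean (\<lambda>y. f3 (y, x))"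
    by (rule mean_cmult)
  also have "mean (\<lambda>y. pd_y g (y, x)) = 0" by (rule mean_pd_y[OF g x])
  finally show ?thesis by (simp add: f2_def f3_def)
qed

text \<open>The averages are the same for every periodic \<open>v\<close>. Taking
  \<open>v = u 1\<close> gives necessity, while \<open>v = 0\<close> turns the system into the
  solvability conditions for the corrector.\<close>

lemma modulation_system_iff:
  assumes v: "profile v"
  shows "modulation_system \<delta> D k0 M0 p0 \<longleftrightarrow>
    (\<forall>x\<in>D. mean (\<lambda>y. rest (y, x) + lin v (y, x)) = 0 \<and> mean (\<lambda>y. U (y, x) * (rest (y, x) + lin v (y, x))) = 0)"
proof -
  let ?W = "wave_profile k0 M0 p0"
  \<comment> \<open>The system is phrased with \<open>wave_profile\<close>, which is known to equal
    \<open>U\<close> only over \<open>D\<close>; openness carries the agreement over to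
    derivatives.\<close>
  have W: "?W (y, x) = U (y, x)" "pd_y ?W (y, x) = pd_y U (y, x)" "pd_y (pd_y ?W) (y, x) = pd_y (pd_y U) (y, x)"
    if "x \<in> D" for x y
  proof -
    show "?W (y, x) = U (y, x)" using that by (rule wave_profile_eq)
    have 1: "pd_y ?W z = pd_y U z" if "z \<in> \<D>" for z
      by (rule pd_y_cong[OF _ smooth_u that]) (auto simp: wave_profile_eq)
    then show "pd_y ?W (y, x) = pd_y U (y, x)" using that by simp
    show "pd_y (pd_y ?W) (y, x) = pd_y (pd_y U) (y, x)"
      by (rule pd_y_cong) (use 1 that in \<open>auto simp: sm\<close>)
  qed
  have "pd_T k0 x + pd_X (\<lambda>x. k0 x * kdv_c (k0 x) (M0 x) (p0 x)) x = 0" if x: "x \<in> D" for x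
  proof -
    have "pd_T k0 x = pd_T k x"
      by (rule directional_cong[OF directional_pd_T open_D k0_eq smooth_k x])
    moreover have "pd_X (\<lambda>x. k0 x * kdv_c (k0 x) (M0 x) (p0 x)) x = pd_X (\<lambda>x. - 1 * \<omega> x) x"
      by (rule directional_cong[OF directional_pd_X open_D _ _ x]) (simp_all add: k0_eq \<omega>_eq sm)
    moreover have "\<dots> = - 1 * pd_X \<omega> x"
      by (rule directional_cmult[OF directional_pd_X open_D _ x]) (simp add: sm)
    moreover have "pd_T k x = pd_X \<omega> x"
      by (rule directional_commute[OF directional_pd_T open_D directional_pd_X smooth_phi x])
    ultimately show ?thesis by simp
  qed
  moreover have "pd_X (\<lambda>x. mean (\<lambda>y. 3 * (?W (y, x))\<^sup>2)) x = pd_X (\<lambda>x. mean (\<lambda>y. 3 * (U (y, x))\<^sup>2)) x"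
    if x: "x \<in> D" for x
    by (rule directional_cong[OF directional_pd_X open_D _ smooth_mean[of "\<lambda>z. 3 * (U z)\<^sup>2"] x])
      (simp_all add: W sm)
  moreover have "pd_T (\<lambda>x. mean (\<lambda>y. (?W (y, x))\<^sup>2)) x = pd_T (\<lambda>x. mean (\<lambda>y. (U (y, x))\<^sup>2)) x"
    if x: "x \<in> D" for x
    by (rule directional_cong[OF directional_pd_T open_D _ smooth_mean[of "\<lambda>z. (U z)\<^sup>2"] x])
      (simp_all add: W sm)
  moreover have "pd_X (\<lambda>x. mean (\<lambda>y. 2 * ?W (y, x) ^ 3 - 3 / 2 * (k0 x)\<^sup>2 * (pd_y ?W (y, x))\<^sup>2)) x
      = pd_X (\<lambda>x. mean (\<lambda>y. 2 * U (y, x) ^ 3 - 3 / 2 * (k x)\<^sup>2 * (pd_y U (y, x))\<^sup>2)) x"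
    if x: "x \<in> D" for x
  proof -
    have "smooth_on D (\<lambda>x. mean (\<lambda>y. 2 * U (y, x) ^ 3 - 3 / 2 * (k x)\<^sup>2 * (pd_y U (y, x))\<^sup>2))"
      using smooth_mean[of "\<lambda>z. 2 * U z ^ 3 - 3 / 2 * (k (snd z))\<^sup>2 * (pd_y U z)\<^sup>2"] by (simp add: sm)
    then show ?thesis
      by (intro directional_cong[OF directional_pd_X open_D _ _ x]) (simp_all add: W k0_eq)
  qed
  ultimately show ?thesis
    unfolding modulation_system_def Let_def
    by (intro ball_cong refl) (simp add: W k0_eq mean_order_0[OF v] mean_U_order_0[OF v])
qed

subsection \<open>Periodic solutions of the linearised equation\<close>

text \<open>The operator \<open>lin\<close> is \<open>k \<partial>\<^sub>y H\<close> with \<open>H f = k\<^sup>2 f'' + 6 V f\<close>. The kernel of \<open>H\<close> is spanned by \<open>V'\<close>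
  and by the following function, found by combining \<open>1\<close>, \<open>V\<close>, \<open>V\<^sup>2\<close>, \<open>y V'\<close> and \<open>(\<integral> V) V'\<close>.\<close>

definition second_solution :: "real \<times> slow \<Rightarrow> real" where
  "second_solution z = 16 * (A (snd z))\<^sup>2 + 18 * B (snd z) * V z - 24 * A (snd z) * (V z)\<^sup>2
     + (9 * B (snd z) * fst z + 12 * A (snd z) * primitive V z) * pd_y V z"

text \<open>\<open>\<Lambda>\<close> will be \<open>k^2\<close> times the Wronskian of
  \<open>V'\<close> and the second solution. \<open>\<alpha>\<close> is the multiple of
  \<open>V'\<close> that the second solution gains over one period: \<open>y\<close> grows by 1 and
  the primitive of \<open>V\<close> by its mean.\<close>

abbreviation "\<Lambda> x \<equiv> 27 * (B x)\<^sup>2 - 16 * A x ^ 3"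
abbreviation "\<alpha> x \<equiv> 9 * B x + 12 * A x * (M0 x - c x / 6)"

lemmas sm' = sm smooth_V smooth_A smooth_B smooth_c smooth_M0 smooth_primitive
lemmas lifts = pd_y_lift[where g = k] pd_y_lift[where g = A] pd_y_lift[where g = B]

lemma smooth_second_solution: "smooth_on \<D> second_solution"
  unfolding second_solution_def[abs_def] by (simp add: sm')

lemma pd_y_pd_y_V:
  assumes x: "x \<in> D"
  shows "(k x)\<^sup>2 * pd_y (pd_y V) (y, x) = A x - 3 * (V (y, x))\<^sup>2"
    and "(k x)\<^sup>2 * (pd_y V (y, x))\<^sup>2 = - 2 * V (y, x) ^ 3 + 2 * A x * V (y, x) + B x"
    and "(k x)\<^sup>2 * pd_y (pd_y (pd_y V)) (y, x) = - 6 * V (y, x) * pd_y V (y, x)"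
proof -
  have 1: "pd_y V z = pd_y U z" if "z \<in> \<D>" for z using that by (auto simp: pd_y_V)
  have 2: "pd_y (pd_y V) z = pd_y (pd_y U) z" if "z \<in> \<D>" for z
    by (rule pd_y_cong[OF 1 _ that]) (auto simp: sm)
  have 3: "pd_y (pd_y (pd_y V)) (y, x) = pd_y (pd_y (pd_y U)) (y, x)"
    by (rule pd_y_cong[OF 2]) (use x in \<open>auto simp: sm\<close>)
  show "(k x)\<^sup>2 * pd_y (pd_y V) (y, x) = A x - 3 * (V (y, x))\<^sup>2"
    "(k x)\<^sup>2 * (pd_y V (y, x))\<^sup>2 = - 2 * V (y, x) ^ 3 + 2 * A x * V (y, x) + B x"
    "(k x)\<^sup>2 * pd_y (pd_y (pd_y V)) (y, x) = - 6 * V (y, x) * pd_y V (y, x)"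
    using x by (simp_all add: 1 2 3 pd_y_y_U pd_y_U_sq pd_y_y_y_U)
qed

lemma pd_y_second_solution:
  "z \<in> \<D> \<Longrightarrow> pd_y second_solution z = 27 * B (snd z) * pd_y V z - 36 * A (snd z) * V z * pd_y V z
     + (9 * B (snd z) * fst z + 12 * A (snd z) * primitive V z) * pd_y (pd_y V) z"
  unfolding second_solution_def[abs_def]
  by (cases z) (simp add: pd_y_simps lifts pd_y_primitive sm', simp add: algebra_simps)

text \<open>After multiplication by \<open>k^2\<close> the derivatives of \<open>V\<close> can be
  eliminated with the profile equations. The terms with \<open>y\<close> and
  \<open>primitive V\<close> cancel because \<open>V'\<close> is in the kernel, the others as
  polynomials in \<open>V\<close>.\<close>

lemma second_solution_kernel:
  assumes x: "x \<in> D"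
  shows "(k x)\<^sup>2 * pd_y (pd_y second_solution) (y, x) + 6 * V (y, x) * second_solution (y, x) = 0"
proof -
  have "pd_y (pd_y second_solution) (y, x) = pd_y (\<lambda>z. 27 * B (snd z) * pd_y V z - 36 * A (snd z) * V z * pd_y V z
     + (9 * B (snd z) * fst z + 12 * A (snd z) * primitive V z) * pd_y (pd_y V) z) (y, x)"
    by (rule pd_y_cong[OF pd_y_second_solution]) (use x in \<open>auto simp: sm'\<close>)
  also have "\<dots> = 27 * B x * pd_y (pd_y V) (y, x) - 36 * A x * ((pd_y V (y, x))\<^sup>2 + V (y, x) * pd_y (pd_y V) (y, x))
     + (9 * B x + 12 * A x * V (y, x)) * pd_y (pd_y V) (y, x)
     + (9 * B x * y + 12 * A x * primitive V (y, x)) * pd_y (pd_y (pd_y V)) (y, x)"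
    using x by (simp add: pd_y_simps lifts pd_y_primitive sm') (simp add: algebra_simps power2_eq_square)
  finally have dd: "pd_y (pd_y second_solution) (y, x) = \<dots>" .
  have "(k x)\<^sup>2 * pd_y (pd_y second_solution) (y, x)
    = 27 * B x * ((k x)\<^sup>2 * pd_y (pd_y V) (y, x))
     - 36 * A x * ((k x)\<^sup>2 * (pd_y V (y, x))\<^sup>2 + V (y, x) * ((k x)\<^sup>2 * pd_y (pd_y V) (y, x)))
     + (9 * B x + 12 * A x * V (y, x)) * ((k x)\<^sup>2 * pd_y (pd_y V) (y, x))
     + (9 * B x * y + 12 * A x * primitive V (y, x)) * ((k x)\<^sup>2 * pd_y (pd_y (pd_y V)) (y, x))"
    unfolding dd by (simp add: algebra_simps)
  then show ?thesis
    unfolding pd_y_pd_y_V[OF x] second_solution_def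
    by (simp add: algebra_simps power2_eq_square power3_eq_cube)
qed

text \<open>The terms with \<open>y\<close> and \<open>primitive V\<close> drop out, since there the
  second solution is a multiple of \<open>V'\<close>. A polynomial in \<open>V\<close> remains,
  constant as Abel's identity predicts for an equation without first-order term.\<close>

lemma second_solution_wronskian:
  assumes x: "x \<in> D"
  shows "(k x)\<^sup>2 * (pd_y V (y, x) * pd_y second_solution (y, x) - pd_y (pd_y V) (y, x) * second_solution (y, x)) = \<Lambda> x"
proof -
  have "(y, x) \<in> \<D>" using x by simp
  note d = pd_y_second_solution[OF this]
  have "(k x)\<^sup>2 * (pd_y V (y, x) * pd_y second_solution (y, x) - pd_y (pd_y V) (y, x) * second_solution (y, x))
    = (27 * B x - 36 * A x * V (y, x)) * ((k x)\<^sup>2 * (pd_y V (y, x))\<^sup>2)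
      - ((k x)\<^sup>2 * pd_y (pd_y V) (y, x)) * (16 * (A x)\<^sup>2 + 18 * B x * V (y, x) - 24 * A x * (V (y, x))\<^sup>2)"
    unfolding d unfolding second_solution_def by (simp add: algebra_simps power2_eq_square)
  then show ?thesis
    unfolding pd_y_pd_y_V[OF x] by (simp add: algebra_simps power2_eq_square power3_eq_cube)
qed

lemma second_solution_translate:
  assumes x: "x \<in> D"
  shows "second_solution (y + 1, x) = second_solution (y, x) + \<alpha> x * pd_y V (y, x)"
proof -
  have "primitive V (y + 1, x) = primitive V (y, x) + (M0 x - c x / 6)"
    using primitive_translate[OF smooth_V smooth_V x, of 0] profile_periodic[OF profile_V x]
    by (simp add: primitive_1 mean_V[OF x])
  then show ?thesis
    using x by (simp add: second_solution_def profile_periodic[OF profile_V] profile_periodic[OF profile_pd_y[OF profile_V]])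
      (simp add: algebra_simps)
qed

text \<open>Orthogonality makes \<open>I1\<close> periodic. Over one period \<open>w\<close> gains
  \<open>\<alpha> V'\<close> and \<open>I2\<close> gains \<open>\<alpha> I1 + I2 (1, x)\<close>; the
  contributions with \<open>I1\<close> cancel in \<open>v\<close>, leaving only a fixed multiple of
  \<open>V'\<close>.\<close>

lemma solve_second_order:
  assumes h: "profile h" and orth: "\<And>x. x \<in> D \<Longrightarrow> mean (\<lambda>y. pd_y V (y, x) * h (y, x)) = 0"
  shows "\<exists>v. profile v \<and> (\<forall>z\<in>\<D>. (k (snd z))\<^sup>2 * pd_y (pd_y v) z + 6 * V z * v z = h z)"
proof -
  note sh = profile_smooth[OF h]
  define w where "w = second_solution"
  define V' where "V' = pd_y V"
  define I1 where "I1 = primitive (\<lambda>z. V' z * h z)"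
  define I2 where "I2 = primitive (\<lambda>z. w z * h z)"
  define r where "r x = 1 / \<Lambda> x" for x
  \<comment> \<open>Chosen so that the gain \<open>\<beta> \<alpha> V'\<close> of the added
    homogeneous solution cancels the remaining \<open>- I2 (1, x) / \<Lambda>\<close> times
    \<open>V'\<close>.\<close>
  define \<beta> where "\<beta> x = I2 (1, x) / (\<Lambda> x * \<alpha> x)" for x
  define v where "v z = r (snd z) * (w z * I1 z - V' z * I2 z) + \<beta> (snd z) * w z" for z
  have pos: "\<Lambda> x \<noteq> 0" "\<alpha> x \<noteq> 0" if "x \<in> D" for x
    using discriminant_pos[OF that] drift_pos[OF that] by auto
  have sI: "smooth_on \<D> w" "smooth_on \<D> V'" "smooth_on \<D> I1" "smooth_on \<D> I2"
    unfolding w_def V'_def I1_def I2_def by (simp_all add: sm' smooth_second_solution sh)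
  have sr: "smooth_on D r" unfolding r_def[abs_def] using pos(1) by (simp add: sm')
  have s\<beta>: "smooth_on D \<beta>" unfolding \<beta>_def[abs_def] using pos by (simp add: sm' sI)
  have sv: "smooth_on \<D> v" unfolding v_def[abs_def] by (simp add: sm sI sr s\<beta>)
  have dI: "pd_y I1 z = V' z * h z" "pd_y I2 z = w z * h z" if "z \<in> \<D>" for z
    using that unfolding I1_def I2_def
    by (cases z, simp add: pd_y_primitive sm sI sh)+
  have dv: "pd_y v z = r (snd z) * (pd_y w z * I1 z - pd_y V' z * I2 z) + \<beta> (snd z) * pd_y w z"
    if "z \<in> \<D>" for z
    unfolding v_def[abs_def] using that
    by (simp add: pd_y_simps pd_y_lift[where g = r] pd_y_lift[where g = \<beta>] sm sI sr s\<beta> dI)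
  have ddv: "pd_y (pd_y v) z = r (snd z) * (pd_y (pd_y w) z * I1 z - pd_y (pd_y V') z * I2 z
      + (V' z * pd_y w z - pd_y V' z * w z) * h z) + \<beta> (snd z) * pd_y (pd_y w) z" if "z \<in> \<D>" for z
  proof -
    have "pd_y (pd_y v) z = pd_y (\<lambda>z. r (snd z) * (pd_y w z * I1 z - pd_y V' z * I2 z) + \<beta> (snd z) * pd_y w z) z"
      by (rule pd_y_cong[OF dv _ that]) (auto simp: sm sI sr s\<beta>)
    then show ?thesis
      using that by (simp add: pd_y_simps pd_y_lift[where g = r] pd_y_lift[where g = \<beta>] sm sI sr s\<beta> dI)
        (simp add: algebra_simps)
  qed
  have "(k x)\<^sup>2 * pd_y (pd_y v) (y, x) + 6 * V (y, x) * v (y, x) = h (y, x)" if x: "x \<in> D" for x y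
  proof -
    let ?H = "\<lambda>f. (k x)\<^sup>2 * pd_y (pd_y f) (y, x) + 6 * V (y, x) * f (y, x)"
    have "(y, x) \<in> \<D>" using x by simp
    then have "?H v = r x * (?H w * I1 (y, x) - ?H V' * I2 (y, x)
      + (k x)\<^sup>2 * (V' (y, x) * pd_y w (y, x) - pd_y V' (y, x) * w (y, x)) * h (y, x)) + \<beta> x * ?H w"
      by (simp add: ddv v_def) (simp add: algebra_simps)
    also have "?H w = 0" unfolding w_def by (rule second_solution_kernel[OF x])
    also have "?H V' = 0" unfolding V'_def using pd_y_pd_y_V(3)[OF x] by simp
    also have "(k x)\<^sup>2 * (V' (y, x) * pd_y w (y, x) - pd_y V' (y, x) * w (y, x)) = \<Lambda> x"
      unfolding w_def V'_def by (rule second_solution_wronskian[OF x])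
    finally show ?thesis using pos[OF x] by (simp add: r_def)
  qed
  moreover have "v (y + 1, x) = v (y, x)" if x: "x \<in> D" for x y
  proof -
    have V': "V' (y + 1, x) = V' (y, x)" for y
      unfolding V'_def by (rule profile_periodic[OF profile_pd_y[OF profile_V] x])
    have w: "w (y + 1, x) = w (y, x) + \<alpha> x * V' (y, x)" for y
      unfolding w_def V'_def by (rule second_solution_translate[OF x])
    have "I1 (y + 1, x) = I1 (y, x) + I1 (1, x)"
      using primitive_translate[OF _ _ x, of "\<lambda>z. V' z * h z" "\<lambda>z. V' z * h z" 0]
      by (simp add: I1_def V' profile_periodic[OF h x] sm sI sh)
    also have "I1 (1, x) = 0" unfolding I1_def V'_def by (simp add: primitive_1 orth[OF x])
    finally have I1: "I1 (y + 1, x) = I1 (y, x)" by simp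
    have I2: "I2 (y + 1, x) = I2 (y, x) + \<alpha> x * I1 (y, x) + I2 (1, x)"
      unfolding I1_def I2_def
      by (rule primitive_translate[OF _ _ x]) (simp_all add: w V' profile_periodic[OF h x] sm sI sh algebra_simps)
    have "v (y + 1, x) = v (y, x) + V' (y, x) * (\<beta> x * \<alpha> x - r x * I2 (1, x))"
      by (simp add: v_def I1 I2 V' w) (simp add: algebra_simps)
    then show ?thesis using pos[OF x] by (simp add: \<beta>_def r_def)
  qed
  ultimately show ?thesis
    using sv by (intro exI[of _ v]) (auto simp: smooth_profile_def)
qed

text \<open>Each condition has its own task: mean zero makes the primitive \<open>G\<close>
  periodic, and orthogonality to \<open>U\<close> becomes, by parts, orthogonality of
  \<open>G\<close> to \<open>V'\<close>. The constant of integration is free because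
  \<open>V'\<close> has mean zero; \<open>primitive\<close> sets \<open>G\<close> to 0 at
  \<open>y = 0\<close>.\<close>

lemma solve_linearised:
  assumes g: "profile g" and mean_g: "\<And>x. x \<in> D \<Longrightarrow> mean (\<lambda>y. g (y, x)) = 0"
    and mean_Ug: "\<And>x. x \<in> D \<Longrightarrow> mean (\<lambda>y. U (y, x) * g (y, x)) = 0"
  shows "\<exists>v. profile v \<and> (\<forall>z\<in>\<D>. lin v z = g z)"
proof -
  define G where "G = primitive g"
  have G: "profile G" unfolding G_def by (rule profile_primitive[OF g mean_g])
  note sG = profile_smooth[OF G] and sg = profile_smooth[OF g]
  have dG: "pd_y G z = g z" if "z \<in> \<D>" for z
    using that pd_y_primitive[OF sg] by (cases z) (simp add: G_def)
  define ik where "ik x = 1 / k x" for x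
  have sik: "smooth_on D ik" unfolding ik_def[abs_def] using k_pos by (simp add: sm less_imp_neq[symmetric])
  have "mean (\<lambda>y. pd_y V (y, x) * (ik x * G (y, x))) = 0" if x: "x \<in> D" for x
  proof -
    have "pd_y V (y, x) * (ik x * G (y, x)) = ik x * (pd_y (\<lambda>z. U z * G z) (y, x) + - 1 * (U (y, x) * g (y, x)))" for y
      using x by (simp add: pd_y_simps sm sG pd_y_V dG algebra_simps)
    then have "mean (\<lambda>y. pd_y V (y, x) * (ik x * G (y, x)))
        = ik x * mean (\<lambda>y. pd_y (\<lambda>z. U z * G z) (y, x) + - 1 * (U (y, x) * g (y, x)))"
      by (simp only: mean_cmult)
    also have "mean (\<lambda>y. pd_y (\<lambda>z. U z * G z) (y, x) + - 1 * (U (y, x) * g (y, x)))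
        = mean (\<lambda>y. pd_y (\<lambda>z. U z * G z) (y, x)) + mean (\<lambda>y. - 1 * (U (y, x) * g (y, x)))"
      using mean_add[OF _ _ x, of "pd_y (\<lambda>z. U z * G z)" "\<lambda>z. - 1 * (U z * g z)"] by (simp add: sm sG sg)
    also have "\<dots> = 0"
      unfolding mean_cmult using mean_pd_y[OF profile_mult[OF profile_u G] x] mean_Ug[OF x] by simp
    finally show ?thesis by simp
  qed
  moreover have ikG: "profile (\<lambda>z. ik (snd z) * G z)" by (intro profile_mult profile_lift sik G)
  ultimately obtain v where v: "profile v"
    and H: "\<And>z. z \<in> \<D> \<Longrightarrow> (k (snd z))\<^sup>2 * pd_y (pd_y v) z + 6 * V z * v z = ik (snd z) * G z"
    using solve_second_order[OF ikG] by auto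
  note sv = profile_smooth[OF v]
  have "lin v z = g z" if z: "z \<in> \<D>" for z
  proof -
    have k: "k (snd z) > 0" using k_pos z by auto
    have "pd_y (\<lambda>z. (k (snd z))\<^sup>2 * pd_y (pd_y v) z + 6 * V z * v z) z = pd_y (\<lambda>z. ik (snd z) * G z) z"
      by (rule pd_y_cong[OF H _ z]) (simp_all add: sm sik sG)
    then have "(k (snd z))\<^sup>2 * pd_y (pd_y (pd_y v)) z + 6 * (pd_y U z * v z + V z * pd_y v z) = ik (snd z) * g z"
      using z by (cases z) (simp add: pd_y_simps pd_y_lift[where g = k] pd_y_lift[where g = ik] sm sv sik sG smooth_V dG pd_y_V algebra_simps)
    then have "k (snd z) * ((k (snd z))\<^sup>2 * pd_y (pd_y (pd_y v)) z + 6 * (pd_y U z * v z + V z * pd_y v z)) = g z"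
      using k by (simp add: ik_def)
    moreover have "6 * (k (snd z) * V z) = 6 * k (snd z) * U z + \<omega> (snd z)"
      using k by (simp add: V_def c_def field_simps)
    then have "6 * (k (snd z) * V z) * pd_y v z = 6 * k (snd z) * U z * pd_y v z + \<omega> (snd z) * pd_y v z"
      by (simp add: distrib_right)
    ultimately show ?thesis
      by (simp add: lin_def algebra_simps power2_eq_square power3_eq_cube)
  qed
  with v show ?thesis by blast
qed

lemma profile_rest: "profile rest"
  unfolding rest_def[abs_def] by (simp add: prof)

lemma lin_0: "lin (\<lambda>_. 0) z = 0"
  by (simp add: lin_def pd_y_def split_beta)

lemma order_0_imp_modulation_system:
  "holds_at_order \<delta> D \<phi> u 0 \<Longrightarrow> modulation_system \<delta> D k0 M0 p0"
  by (simp add: modulation_system_iff[OF profile_u[of 1]] holds_at_order_def residual_order_0 mean_def)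

lemma modulation_system_imp_solvable:
  assumes "modulation_system \<delta> D k0 M0 p0"
  shows "\<exists>v. profile v \<and> (\<forall>z\<in>\<D>. rest z + lin v z = 0)"
proof -
  have m: "mean (\<lambda>y. rest (y, x)) = 0" "mean (\<lambda>y. U (y, x) * rest (y, x)) = 0" if "x \<in> D" for x
    using assms that by (simp_all add: modulation_system_iff[OF profile_const[of 0]] lin_0)
  have "\<exists>v. profile v \<and> (\<forall>z\<in>\<D>. lin v z = - 1 * rest z)"
  proof (rule solve_linearised)
    show "profile (\<lambda>z. - 1 * rest z)" by (intro profile_mult profile_const profile_rest)
    show "mean (\<lambda>y. - 1 * rest (y, x)) = 0" if "x \<in> D" for x
      unfolding mean_cmult by (simp add: m(1)[OF that])
    have "mean (\<lambda>y. - 1 * (U (y, x) * rest (y, x))) = 0" if "x \<in> D" for x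
      unfolding mean_cmult by (simp add: m(2)[OF that])
    then show "mean (\<lambda>y. U (y, x) * (- 1 * rest (y, x))) = 0" if "x \<in> D" for x
      using that by simp
  qed
  then show ?thesis by auto
qed

end

section \<open>Constant solutions\<close>

text \<open>All slow derivatives of constants vanish, so the first two equations are trivial and the
  third loses its left-hand side; the positive factor \<open>\<delta> k^2\<close> is cancelled. A
  point of \<open>D\<close> is needed to read off the balance.\<close>

lemma modulation_system_const_iff:
  assumes "\<delta> > 0" "D \<noteq> {}" and k: "k > 0" and p: "0 < p" "p < 1"
  shows "modulation_system \<delta> D (\<lambda>_. k) (\<lambda>_. M) (\<lambda>_. p) \<longleftrightarrow>
    mean (\<lambda>y. (deriv (\<lambda>s. kdv_U s k M p) y)\<^sup>2) =
    k\<^sup>2 * mean (\<lambda>y. ((deriv ^^ 2) (\<lambda>s. kdv_U s k M p) y)\<^sup>2)"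
proof -
  let ?U = "\<lambda>s. kdv_U s k M p"
  let ?W = "wave_profile (\<lambda>_. k) (\<lambda>_. M) (\<lambda>_. p)"
  obtain U' A B where U:
    "\<And>y. (?U has_real_derivative U' y) (at y)"
    "\<And>y. (U' has_real_derivative (A - 3 * (?U y - kdv_c k M p / 6)\<^sup>2) / k\<^sup>2) (at y)"
    by (rule kdv_wave_ode[OF k p, of M]) (rule that; assumption)
  have d1: "deriv ?U = U'" using DERIV_imp_deriv[OF U(1)] by (rule ext)
  have d2: "(deriv ^^ 2) ?U = deriv U'" by (simp add: numeral_2_eq_2 d1)
  have dd: "deriv U' y = (A - 3 * (?U y - kdv_c k M p / 6)\<^sup>2) / k\<^sup>2" for y
    using U(2) by (rule DERIV_imp_deriv)
  have W: "?W (y, x) = ?U y" "pd_y ?W (y, x) = U' y" "pd_y (pd_y ?W) (y, x) = deriv U' y" for y x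
    by (simp_all add: pd_y_def wave_profile_def d1)
  have cont: "continuous_on {0..1} U'" "continuous_on {0..1} ?U"
    by (rule DERIV_continuous_on[OF has_field_derivative_at_within[OF U(2)]],
        rule DERIV_continuous_on[OF has_field_derivative_at_within[OF U(1)]])
  then have "continuous_on {0..1} (deriv U')"
    unfolding dd[abs_def] using k by (intro continuous_intros) auto
  then have "mean (\<lambda>y. (U' y)\<^sup>2 - k\<^sup>2 * (deriv U' y)\<^sup>2) = mean (\<lambda>y. (U' y)\<^sup>2) - k\<^sup>2 * mean (\<lambda>y. (deriv U' y)\<^sup>2)"
    unfolding mean_def integral_mult_right[symmetric]
    using cont by (intro integral_diff integrable_continuous_real continuous_intros)
  moreover have "pd_X (\<lambda>_. a) x = 0" "pd_T (\<lambda>_. a) x = 0" for a x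
    by (simp_all add: pd_X_def pd_T_def split_beta)
  ultimately show ?thesis
    using assms unfolding modulation_system_def Let_def W d1 d2 by auto
qed

theorem mainTheorem6:
  fixes \<delta> :: real and D :: "(real \<times> real) set"
  assumes "\<delta> \<ge> 0" and "open D" and "D \<noteq> {}"
  shows
    "(\<forall>\<phi> u k0 M0 p0. formal_ansatz D \<phi> u \<and> modulated_wave D (\<phi> 0) (u 0) k0 M0 p0 \<longrightarrow>
        holds_at_order \<delta> D \<phi> u (-1) \<and>
        (holds_at_order \<delta> D \<phi> u 0 \<longrightarrow> modulation_system \<delta> D k0 M0 p0) \<and>
        (modulation_system \<delta> D k0 M0 p0 \<longrightarrow>
          (\<forall>\<phi>1. smooth_on D \<phi>1 \<longrightarrow>
            (\<exists>u1. smooth_profile D u1 \<and> holds_at_order \<delta> D (\<phi>(1 := \<phi>1)) (u(1 := u1)) 0)))) \<and>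
     (\<delta> > 0 \<longrightarrow>
       (\<forall>k M p. k > 0 \<and> p \<in> {0<..<1} \<longrightarrow>
         (modulation_system \<delta> D (\<lambda>_. k) (\<lambda>_. M) (\<lambda>_. p) \<longleftrightarrow>
          mean (\<lambda>y. (deriv (\<lambda>s. kdv_U s k M p) y)\<^sup>2) =
          k\<^sup>2 * mean (\<lambda>y. ((deriv ^^ 2) (\<lambda>s. kdv_U s k M p) y)\<^sup>2))))"
proof (intro conjI allI impI; (elim conjE)?)
  fix \<phi> u k0 M0 p0
  assume a: "formal_ansatz D \<phi> u" "modulated_wave D (\<phi> 0) (u 0) k0 M0 p0"
  then interpret modulated_ansatz D \<delta> \<phi> u k0 M0 p0
    using \<open>open D\<close> by unfold_locales
  show "holds_at_order \<delta> D \<phi> u (-1)"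
    by (simp add: holds_at_order_def residual_order_minus_1)
  show "modulation_system \<delta> D k0 M0 p0" if "holds_at_order \<delta> D \<phi> u 0"
    using that by (rule order_0_imp_modulation_system)
  fix \<phi>1
  assume m: "modulation_system \<delta> D k0 M0 p0" and \<phi>1: "smooth_on D \<phi>1"
  have replaced: "modulated_ansatz D (\<phi>(1 := \<phi>1)) (u(1 := u1)) k0 M0 p0" if "smooth_profile D u1" for u1
    using a \<phi>1 that \<open>open D\<close> by unfold_locales (auto simp: formal_ansatz_def)
  \<comment> \<open>The corrector has to be found for the new \<open>\<phi>1\<close> before it can
    be part of an ansatz; the zero corrector is a placeholder that makes the solvability result
    available.\<close>
  interpret zero: modulated_ansatz D \<delta> "\<phi>(1 := \<phi>1)" "u(1 := \<lambda>_. 0)" k0 M0 p0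
    by (rule replaced[OF profile_const])
  obtain u1 where u1: "smooth_profile D u1" "\<And>z. z \<in> \<D> \<Longrightarrow> zero.rest z + zero.lin u1 z = 0"
    using zero.modulation_system_imp_solvable[OF m] by blast
  interpret one: modulated_ansatz D \<delta> "\<phi>(1 := \<phi>1)" "u(1 := u1)" k0 M0 p0
    by (rule replaced[OF u1(1)])
  \<comment> \<open>Both depend on the phases and on \<open>u 0\<close> only, so inserting the
    solution as the first corrector does not change the equation that it solves.\<close>
  have "one.rest z = zero.rest z" "one.lin u1 z = zero.lin u1 z" for z
    unfolding one.rest_def zero.rest_def one.lin_def zero.lin_def by simp_all
  moreover have "(u(1 := u1)) 1 = u1" by simp
  ultimately have "fls_nth (residual \<delta> (\<phi>(1 := \<phi>1)) (u(1 := u1)) (y, x)) 0 = 0" if "x \<in> D" for y x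
    using one.residual_order_0[OF that, of y] u1(2)[of "(y, x)"] that by simp
  then have "holds_at_order \<delta> D (\<phi>(1 := \<phi>1)) (u(1 := u1)) 0"
    unfolding holds_at_order_def by blast
  with u1(1) show "\<exists>u1. smooth_profile D u1 \<and> holds_at_order \<delta> D (\<phi>(1 := \<phi>1)) (u(1 := u1)) 0"
    by blast
next
  fix k M p :: real
  assume "\<delta> > 0" "k > 0" "p \<in> {0<..<1}"
  then show "modulation_system \<delta> D (\<lambda>_. k) (\<lambda>_. M) (\<lambda>_. p) \<longleftrightarrow>
          mean (\<lambda>y. (deriv (\<lambda>s. kdv_U s k M p) y)\<^sup>2) =
          k\<^sup>2 * mean (\<lambda>y. ((deriv ^^ 2) (\<lambda>s. kdv_U s k M p) y)\<^sup>2)"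
    using \<open>D \<noteq> {}\<close> by (intro modulation_system_const_iff) auto
qed

end
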